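(* Let $0 < q \leq 1$, $\nu > -1$, $t = \frac{\nu+2}{q}$, $\beta > \frac{\nu+2}{q}-2$, and let $f \in A^\infty_{\frac{\nu+2}{q}}(\mathbb{C}_+)$. Put $$t_1 = \mathrm{dist}_{A^\infty_{\frac{\nu+2}{q}}(\mathbb{C}_+)}\bigl(f, A^q_\nu(\mathbb{C}_+)\bigr)$$ and $$t_2 = \inf\left\{\epsilon > 0 : \int_{\mathbb{C}_+}\left(\int_{V_{\epsilon,t}(f)} \frac{(\Im w)^{\beta-t}\, dm_2(w)}{|\overline{w}-z|^{\beta+2}}\right)^q (\Im z)^\nu\, dm_2(z) < \infty\right\},$$ where $V_{\epsilon,t}(f) = \{z = x+iy \in \mathbb{C}_+ : |f(x+iy)|\,y^t \geq \epsilon\}$. Then $t_1 = t_2$.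
   Context: $\mathbb{C}_+ = \{x+iy : y > 0\}$ is the upper half-plane, $H(\mathbb{C}_+)$ is the space of holomorphic functions on $\mathbb{C}_+$, and $m_2$ is two-dimensional Lebesgue measure. For $\alpha > -1$ and $0 < p < \infty$, the weighted Bergman space $A^p_\alpha(\mathbb{C}_+)$ consists of all $f \in H(\mathbb{C}_+)$ with $$\|f\|_{p,\alpha} = \left(\int_0^\infty\int_{-\infty}^\infty |f(x+iy)|^p y^\alpha\, dx\, dy\right)^{1/p} < \infty.$$ For $\mu > 0$, $A^\infty_\mu(\mathbb{C}_+)$ consists of all $F \in H(\mathbb{C}_+)$ with $$\|F\|_{A^\infty_\mu} = \sup_{y>0}\sup_{x\in\mathbb{R}} |F(x+iy)|\, y^\mu < \infty.$$ For a normed space $Y$, a subset $X \subset Y$ and $f\in Y$, $\mathrm{dist}_Y(f,X) = \inf_{g\in X}\|f-g\|_Y$. The infimum of the empty set is $+\infty$. *)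

theory Defs
  imports "HOL-Analysis.Analysis"
begin

definition upper_half_plane :: "complex set" (\<open>\<complex>\<^sub>+\<close>) where
  "\<complex>\<^sub>+ = {z. 0 < Im z}"

text \<open>Only exponents \<open>a > 0\<close> are used below, so that \<open>0\<close> is sent to \<open>0\<close> and
  \<open>\<infinity>\<close> to \<open>\<infinity>\<close>.\<close>

definition ennreal_powr :: "ennreal \<Rightarrow> real \<Rightarrow> ennreal" where
  "ennreal_powr x a = (if x = \<infinity> then \<infinity> else ennreal (enn2real x powr a))"

text \<open>Functions on the half-plane are total functions on \<^typ>\<open>complex\<close> whose values off
  \<open>\<complex>\<^sub>+\<close> play no role: the norms below, and hence the distances, ignore them. Norms are
  extended-valued, and a space consists of the holomorphic functions of finite norm.
  For \<open>p < 1\<close> the Bergman "norm" is only a quasi-norm.\<close>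

definition bergman_norm :: "real \<Rightarrow> real \<Rightarrow> (complex \<Rightarrow> complex) \<Rightarrow> ennreal" where
  "bergman_norm p \<alpha> f =
     ennreal_powr
       (\<integral>\<^sup>+y\<in>{0<..}. (\<integral>\<^sup>+x. ennreal (norm (f (Complex x y)) powr p * y powr \<alpha>) \<partial>lborel) \<partial>lborel)
       (1 / p)"

definition bergman_space :: "real \<Rightarrow> real \<Rightarrow> (complex \<Rightarrow> complex) set" where
  "bergman_space p \<alpha> = {f. f holomorphic_on \<complex>\<^sub>+ \<and> bergman_norm p \<alpha> f < \<infinity>}"

definition growth_norm :: "real \<Rightarrow> (complex \<Rightarrow> complex) \<Rightarrow> ennreal" where
  "growth_norm \<mu> F = (SUP y\<in>{0<..}. SUP x. ennreal (norm (F (Complex x y)) * y powr \<mu>))"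

definition growth_space :: "real \<Rightarrow> (complex \<Rightarrow> complex) set" where
  "growth_space \<mu> = {F. F holomorphic_on \<complex>\<^sub>+ \<and> growth_norm \<mu> F < \<infinity>}"

definition dist_wrt ::
    "((complex \<Rightarrow> complex) \<Rightarrow> ennreal) \<Rightarrow> (complex \<Rightarrow> complex) \<Rightarrow> (complex \<Rightarrow> complex) set \<Rightarrow> ennreal"
  where "dist_wrt N f X = (INF g\<in>X. N (\<lambda>z. f z - g z))"

definition V_set :: "real \<Rightarrow> real \<Rightarrow> (complex \<Rightarrow> complex) \<Rightarrow> complex set" where
  "V_set \<epsilon> t f = {z \<in> \<complex>\<^sub>+. norm (f z) * Im z powr t \<ge> \<epsilon>}"

end

theory Submission
  imports Defs "HOL-Complex_Analysis.Cauchy_Integral_Formula"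
begin

text \<open>
  Both sides of the formula equal the limsup of \<open>\<bar>f z\<bar> (Im z)\<^bsup>t\<^esup>\<close> at the boundary of the half-plane,
  the point at infinity included: the infimum of all \<open>e\<close> such that \<open>V_set e t f\<close> is contained in a
  compact subset of the half-plane.

  The exponents are scale invariant. Since \<open>tq = \<nu> + 2\<close>, a hyperbolic ball of fixed size around a
  point of \<open>V_set \<epsilon> t f\<close> that lies inside \<open>V_set \<epsilon> t f\<close> adds at least a fixed amount to the integral
  that defines the right-hand side. Slightly lowering the level thickens a superlevel set by such
  balls, so finiteness at the level \<open>\<epsilon>\<close> forces the superlevel sets of all levels above \<open>\<epsilon>\<close> to be
  relatively compact (\<open>V_set_window_if_integral_finite\<close>). Conversely, the integral over a relatively
  compact set is finite because \<open>(\<beta> + 2) q > \<nu> + 2\<close> (\<open>integral_finite_if_window\<close>).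

  The distance is at least the limsup because a function \<open>g\<close> in the Bergman space satisfies
  \<open>\<bar>g z\<bar> (Im z)\<^bsup>t\<^esup> \<rightarrow> 0\<close> at the boundary (\<open>bergman_space_vanishes_at_boundary\<close>); this again says that a
  finite mass cannot be large on infinitely many disjoint hyperbolic balls of fixed size.

  The distance is at most the limsup by an averaging argument. There are Bergman functions that
  converge to \<open>f\<close> uniformly on compact sets and obey the same growth bound \<open>M\<close> as \<open>f\<close>
  (\<open>bergman_space_bounded_approximation\<close>). A single one of them may be at a distance of up to \<open>2M\<close> from
  \<open>f\<close> in the region where it passes from being close to \<open>f\<close> to being small. If \<open>N\<close> of them are
  chosen with transition regions that are pairwise disjoint, then at every point at most one summand
  of their average is in transition, which costs \<open>2M / N\<close>; the other summands are close to \<open>f\<close> or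
  small, and the latter leave an error of at most the limsup (\<open>dist_bergman_le\<close>).
\<close>

section \<open>A local lower bound for \<open>L\<^sup>q\<close> means\<close>

lemma emeasure_complex_ball:
  "0 \<le> r \<Longrightarrow> emeasure lborel (ball (z::complex) r) = ennreal (pi * r\<^sup>2)"
  by (simp add: emeasure_ball unit_ball_vol_2)

text \<open>Cauchy's estimate bounds the derivative on the half ball.\<close>

lemma holomorphic_lipschitz_half_ball:
  assumes g: "g holomorphic_on ball z r"
    and B: "\<And>w. w \<in> ball z r \<Longrightarrow> norm (g w) \<le> B"
    and w: "w \<in> ball z (r / 2)"
  shows "norm (g w - g z) \<le> 4 * B / r * norm (w - z)"
proof -
  have r: "r > 0"
  proof -
    have "0 \<le> dist z w" "dist z w < r / 2" using w by auto
    then show ?thesis by linarith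
  qed
  have deriv_le: "norm (deriv g \<xi>) \<le> 4 * B / r" if \<xi>: "\<xi> \<in> ball z (r / 2)" for \<xi>
  proof -
    have sub: "cball \<xi> (r / 4) \<subseteq> ball z r"
    proof
      fix x assume "x \<in> cball \<xi> (r / 4)"
      then have "dist z x \<le> dist z \<xi> + r / 4"
        using dist_triangle[of z x \<xi>] by simp
      also have "\<dots> < r" using \<xi> r by simp
      finally show "x \<in> ball z r" by simp
    qed
    have "norm ((deriv ^^ 1) g \<xi>) \<le> fact 1 * B / (r / 4) ^ 1"
    proof (rule Cauchy_inequality)
      show "g holomorphic_on ball \<xi> (r / 4)"
        using g sub ball_subset_cball holomorphic_on_subset by blast
      show "continuous_on (cball \<xi> (r / 4)) g"
        using g sub holomorphic_on_imp_continuous_on continuous_on_subset by blast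
      show "norm (g x) \<le> B" if "norm (\<xi> - x) = r / 4" for x
        using that sub by (intro B) (auto simp: dist_norm)
    qed (use r in auto)
    then show ?thesis by (simp add: field_simps)
  qed
  show ?thesis
  proof (rule field_differentiable_bound[where S = "ball z (r / 2)" and f' = "deriv g"])
    show "(g has_field_derivative deriv g \<xi>) (at \<xi> within ball z (r / 2))"
      if "\<xi> \<in> ball z (r / 2)" for \<xi>
    proof -
      have "\<xi> \<in> ball z r" using that r by simp
      then show ?thesis
        using g holomorphic_derivI has_field_derivative_at_within open_ball by blast
    qed
  qed (use w r deriv_le in auto)
qed

text \<open>A substitute for the subharmonicity of \<open>\<bar>g\<bar>\<^sup>q\<close> that needs only Cauchy's estimate. Let \<open>w0\<close> be
  a maximum point of \<open>\<bar>g w\<bar> (r - \<bar>w - z\<bar>)\<^bsup>2/q\<^esup>\<close> over the closed disc. On the disc around \<open>w0\<close> that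
  reaches halfway to the boundary, \<open>\<bar>g\<bar>\<close> is at most a constant multiple of \<open>\<bar>g w0\<bar>\<close>, so \<open>g\<close> varies
  slowly there, and \<open>\<bar>g\<bar>\<close> stays above half of \<open>\<bar>g w0\<bar>\<close> on a smaller disc of comparable radius. The
  exponent \<open>2/q\<close> makes the \<open>q\<close>-th power of the weight an area, so that this smaller disc already
  carries the asserted mass.\<close>

lemma local_Lq_lower_bound:
  fixes q :: real
  assumes q: "q > 0"
  obtains C where "C > 0"
    "\<And>(g :: complex \<Rightarrow> complex) z r. \<lbrakk>0 < r; continuous_on (cball z r) g; g holomorphic_on ball z r\<rbrakk> \<Longrightarrow>
      ennreal (C * (norm (g z) powr q * r\<^sup>2)) \<le> (\<integral>\<^sup>+w\<in>ball z r. ennreal (norm (g w) powr q) \<partial>lborel)"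
proof -
  define K :: real where "K = 2 powr (2 / q)"
  have K: "K \<ge> 1" using q by (simp add: K_def ge_one_powr_ge_zero)
  define C :: real where "C = (1/2) powr q * pi / (256 * K\<^sup>2)"
  have "C > 0" using K by (simp add: C_def)
  moreover have "ennreal (C * (norm (g z) powr q * r\<^sup>2)) \<le> (\<integral>\<^sup>+w\<in>ball z r. ennreal (norm (g w) powr q) \<partial>lborel)"
    if r: "0 < r" and cont: "continuous_on (cball z r) g" and hol: "g holomorphic_on ball z r"
    for g :: "complex \<Rightarrow> complex" and z r
  proof (cases "g z = 0")
    case True
    then show ?thesis by simp
  next
    case False
    define h where "h w = norm (g w) * (r - dist z w) powr (2 / q)" for w
    have "continuous_on (cball z r) h"
      unfolding h_def using q by (intro continuous_intros cont continuous_on_powr') auto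
    then obtain w0 where w0: "w0 \<in> cball z r" "\<And>w. w \<in> cball z r \<Longrightarrow> h w \<le> h w0"
      using continuous_attains_sup[of "cball z r" h] r by auto
    have hz: "h z = norm (g z) * r powr (2 / q)" by (simp add: h_def)
    have "0 < h z" using False r by (simp add: hz)
    also have hzw0: "h z \<le> h w0" using w0(2) r by simp
    finally have hpos: "0 < h w0" .
    define \<rho> where "\<rho> = (r - dist z w0) / 2"
    have \<rho>: "\<rho> > 0"
    proof -
      have "dist z w0 \<noteq> r" using hpos by (auto simp: h_def)
      then show ?thesis using w0(1) by (simp add: \<rho>_def)
    qed
    have gap: "r - dist z w0 = 2 * \<rho>" by (simp add: \<rho>_def)
    have g0: "norm (g w0) > 0" using hpos by (auto simp: h_def)
    have sub: "ball w0 \<rho> \<subseteq> ball z r"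
    proof
      fix w assume "w \<in> ball w0 \<rho>"
      then have "dist z w < dist z w0 + \<rho>" using dist_triangle[of z w w0] by simp
      then show "w \<in> ball z r" using \<rho> by (simp add: \<rho>_def field_simps)
    qed
    have bound: "norm (g w) \<le> K * norm (g w0)" if "w \<in> ball w0 \<rho>" for w
    proof -
      have "dist z w < dist z w0 + \<rho>" using dist_triangle[of z w w0] that by simp
      then have 1: "\<rho> \<le> r - dist z w" by (simp add: \<rho>_def field_simps)
      have "norm (g w) * \<rho> powr (2/q) \<le> h w"
        unfolding h_def using 1 \<rho> q by (intro mult_left_mono powr_mono2) auto
      also have "\<dots> \<le> h w0" using sub that by (intro w0(2)) auto
      also have "\<dots> = norm (g w0) * (2 * \<rho>) powr (2/q)"
        by (simp only: h_def gap)
      also have "\<dots> = K * norm (g w0) * \<rho> powr (2/q)"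
        using \<rho> by (simp add: powr_mult K_def)
      finally show ?thesis using \<rho> by simp
    qed
    \<comment> \<open>On this radius the Lipschitz bound lets \<open>g\<close> drop by at most half of \<open>\<bar>g w0\<bar>\<close>.\<close>
    define s where "s = \<rho> / (8 * K)"
    have s: "s > 0" "s < \<rho> / 2" using \<rho> K by (auto simp: s_def field_simps)
    have low: "norm (g w0) / 2 \<le> norm (g w)" if w: "w \<in> ball w0 s" for w
    proof -
      have "norm (g w - g w0) \<le> 4 * (K * norm (g w0)) / \<rho> * norm (w - w0)"
        using w s
        by (intro holomorphic_lipschitz_half_ball holomorphic_on_subset[OF hol sub] bound) auto
      also have "\<dots> \<le> 4 * (K * norm (g w0)) / \<rho> * s"
        using w \<rho> K by (intro mult_left_mono) (auto simp: dist_norm norm_minus_commute)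
      also have "\<dots> = norm (g w0) / 2" using \<rho> K by (simp add: s_def field_simps)
      finally show ?thesis using norm_triangle_ineq2[of "g w0" "g w"] by (simp add: norm_minus_commute)
    qed
    have "norm (g z) powr q * r\<^sup>2 = h z powr q"
      using q r by (simp add: hz powr_mult powr_powr)
    also have "\<dots> \<le> h w0 powr q" using hzw0 \<open>0 < h z\<close> q by (intro powr_mono2) auto
    also have "\<dots> = norm (g w0) powr q * (2 * \<rho>)\<^sup>2"
      using \<rho> q by (simp add: h_def gap powr_mult powr_powr)
    finally have "C * (norm (g z) powr q * r\<^sup>2) \<le> C * (norm (g w0) powr q * (2 * \<rho>)\<^sup>2)"
      using \<open>C > 0\<close> by (intro mult_left_mono) auto
    also have "\<dots> = (norm (g w0) / 2) powr q * (pi * s\<^sup>2)"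
      using K by (simp add: C_def s_def powr_divide field_simps power2_eq_square)
    finally have "ennreal (C * (norm (g z) powr q * r\<^sup>2)) \<le> ennreal ((norm (g w0) / 2) powr q * (pi * s\<^sup>2))"
      by (rule ennreal_leI)
    also have "\<dots> = (\<integral>\<^sup>+w\<in>ball w0 s. ennreal ((norm (g w0) / 2) powr q) \<partial>lborel)"
      using s by (simp add: nn_integral_cmult_indicator emeasure_complex_ball ennreal_mult)
    also have "\<dots> \<le> (\<integral>\<^sup>+w\<in>ball z r. ennreal (norm (g w) powr q) \<partial>lborel)"
    proof (intro nn_integral_mono)
      fix w
      have "ball w0 s \<subseteq> ball z r" using sub s by force
      then show "ennreal ((norm (g w0) / 2) powr q) * indicator (ball w0 s) w
          \<le> ennreal (norm (g w) powr q) * indicator (ball z r) w"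
        using low[of w] q by (auto simp: indicator_def intro!: ennreal_leI powr_mono2)
    qed
    finally show ?thesis .
  qed
  ultimately show ?thesis using that by blast
qed

section \<open>Sets that are compact in the half-plane\<close>

text \<open>An exhaustion of the half-plane by compact sets; a function tends to zero at the boundary
  (the point at infinity included) when each of its superlevel sets lies in one of them.\<close>

definition window :: "real \<Rightarrow> complex set" where
  "window R = {z. 1 / R \<le> Im z \<and> norm z \<le> R}"

lemma window_subset: "0 < R \<Longrightarrow> window R \<subseteq> \<complex>\<^sub>+"
  unfolding window_def upper_half_plane_def
  by (auto intro: less_le_trans[of 0 "1 / R"])

lemma window_mono: "0 < R \<Longrightarrow> R \<le> R' \<Longrightarrow> window R \<subseteq> window R'"
  unfolding window_def by (auto intro: order_trans[OF divide_left_mono])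

lemma compact_window: "compact (window R)"
proof -
  have "closed {z. 1 / R \<le> Im z}" by (intro closed_Collect_le continuous_intros)
  then have "compact ({z. 1 / R \<le> Im z} \<inter> cball 0 R)" by (intro closed_Int_compact) auto
  also have "{z. 1 / R \<le> Im z} \<inter> cball 0 R = window R"
    by (auto simp: window_def)
  finally show ?thesis .
qed

lemma open_upper_half_plane: "open \<complex>\<^sub>+"
  unfolding upper_half_plane_def by (intro open_Collect_less continuous_intros)

lemma Im_bounds_hyperbolic_ball:
  assumes "u \<in> ball w (c * Im w)"
  shows "(1 - c) * Im w \<le> Im u" "Im u \<le> (1 + c) * Im w"
proof -
  have "\<bar>Im u - Im w\<bar> \<le> dist w u"
    using abs_Im_le_cmod[of "u - w"] by (simp add: dist_norm norm_minus_commute)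
  then show "(1 - c) * Im w \<le> Im u" "Im u \<le> (1 + c) * Im w"
    using assms by (auto simp: algebra_simps)
qed

lemma hyperbolic_ball_subset:
  assumes "w \<in> \<complex>\<^sub>+" "c \<le> 1/2"
  shows "ball w (c * Im w) \<subseteq> \<complex>\<^sub>+"
proof
  fix u assume u: "u \<in> ball w (c * Im w)"
  have "0 < (1 - c) * Im w" using assms by (simp add: upper_half_plane_def)
  then show "u \<in> \<complex>\<^sub>+" using Im_bounds_hyperbolic_ball(1)[OF u] by (simp add: upper_half_plane_def)
qed

text \<open>The tails of a finite integral, taken over the complements of the windows, tend to zero. Once
  a tail is below \<open>\<kappa>\<close>, the ball around any point of \<open>S\<close> must meet the window, and a ball with radius
  proportional to the height of its centre can do so only if the centre lies in a slightly larger
  window.\<close>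

lemma window_if_uniform_mass:
  fixes F :: "complex \<Rightarrow> ennreal"
  assumes F [measurable]: "F \<in> borel_measurable borel"
    and fin: "(\<integral>\<^sup>+z\<in>\<complex>\<^sub>+. F z \<partial>lborel) < \<infinity>"
    and c: "c \<le> 1/2" and \<kappa>: "\<kappa> > 0"
    and S: "S \<subseteq> \<complex>\<^sub>+"
    and low: "\<And>w. w \<in> S \<Longrightarrow> \<kappa> \<le> (\<integral>\<^sup>+z\<in>ball w (c * Im w). F z \<partial>lborel)"
  obtains R where "R > 0" "S \<subseteq> window R"
proof -
  have [measurable]: "\<complex>\<^sub>+ \<in> sets borel" "\<And>R. window R \<in> sets borel"
    using open_upper_half_plane compact_window by (auto intro: borel_compact)
  define u where "u n z = F z * indicator (\<complex>\<^sub>+ - window (real (Suc n))) z" for n z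
  have [measurable]: "u n \<in> borel_measurable borel" for n
    unfolding u_def by measurable
  have "(\<lambda>n. \<integral>\<^sup>+z. u n z \<partial>lborel) \<longlonglongrightarrow> (\<integral>\<^sup>+z. 0 \<partial>(lborel::complex measure))"
  proof (rule nn_integral_dominated_convergence[where w = "\<lambda>z. F z * indicator \<complex>\<^sub>+ z"])
    show "AE z in lborel. (\<lambda>n. u n z) \<longlonglongrightarrow> 0"
    proof (rule AE_I2)
      fix z
      have "\<forall>\<^sub>F n in sequentially. u n z = 0"
      proof (cases "z \<in> \<complex>\<^sub>+")
        case True
        then have pos: "Im z > 0" by (simp add: upper_half_plane_def)
        obtain N where N: "real N \<ge> max (norm z) (1 / Im z)" using real_arch_simple by blast
        have "u n z = 0" if "n \<ge> N" for n
        proof -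
          have *: "norm z \<le> real (Suc n)" "1 / Im z \<le> real (Suc n)" using N that by auto
          then have "1 / real (Suc n) \<le> Im z" using pos by (simp add: field_simps)
          then show ?thesis using * by (simp add: u_def window_def)
        qed
        then show ?thesis by (auto simp: eventually_sequentially)
      qed (simp add: u_def)
      then show "(\<lambda>n. u n z) \<longlonglongrightarrow> 0" by (rule tendsto_eventually)
    qed
  qed (use fin in \<open>auto simp: u_def indicator_def\<close>)
  then have "(\<lambda>n. \<integral>\<^sup>+z. u n z \<partial>lborel) \<longlonglongrightarrow> 0" by simp
  from order_tendstoD(2)[OF this \<kappa>] obtain n where n: "(\<integral>\<^sup>+z. u n z \<partial>lborel) < \<kappa>"
    by (auto simp: eventually_sequentially)
  define R where "R = real (Suc n)"
  have R: "R > 0" by (simp add: R_def)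
  have "S \<subseteq> window (2 * R)"
  proof
    fix w assume w: "w \<in> S"
    then have wpos: "Im w > 0" using S by (auto simp: upper_half_plane_def)
    have "\<exists>v \<in> ball w (c * Im w). v \<in> window R"
    proof (rule ccontr)
      assume "\<not> ?thesis"
      moreover have "ball w (c * Im w) \<subseteq> \<complex>\<^sub>+"
        using c w S by (intro hyperbolic_ball_subset) auto
      ultimately have "(\<integral>\<^sup>+z\<in>ball w (c * Im w). F z \<partial>lborel) \<le> (\<integral>\<^sup>+z. u n z \<partial>lborel)"
        by (intro nn_integral_mono) (auto simp: u_def R_def indicator_def)
      then show False using low[OF w] n by (meson not_le order_trans)
    qed
    then obtain v where v: "v \<in> ball w (c * Im w)" "1 / R \<le> Im v" "norm v \<le> R"
      by (auto simp: window_def)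
    have half: "c * Im w \<le> Im w / 2" using c wpos by simp
    have "Im v \<le> 2 * Im w" using Im_bounds_hyperbolic_ball(2)[OF v(1)] half wpos unfolding distrib_right by linarith
    then have 1: "1 / (2 * R) \<le> Im w" using v(2) by simp
    have "Im w / 2 \<le> Im v" using Im_bounds_hyperbolic_ball(1)[OF v(1)] half unfolding left_diff_distrib by linarith
    also have "\<dots> \<le> R" using v(3) abs_Im_le_cmod[of v] by simp
    finally have "norm (w - v) \<le> R" using v(1) half by (simp add: dist_norm)
    then have "norm w \<le> 2 * R" using v(3) norm_triangle_ineq[of "w - v" v] by simp
    with 1 show "w \<in> window (2 * R)" by (simp add: window_def)
  qed
  then show ?thesis using R that[of "2 * R"] by simp
qed

section \<open>Bergman functions vanish at the boundary\<close>

lemma borel_measurable_Complex [measurable]: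
  "(\<lambda>p. Complex (fst p) (snd p)) \<in> borel_measurable (lborel \<Otimes>\<^sub>M lborel)"
proof -
  have "(\<lambda>p. Complex (fst p) (snd p)) \<in> borel_measurable borel"
    by (intro borel_measurable_continuous_onI continuous_intros)
  then show ?thesis by (simp add: lborel_prod)
qed

lemma lborel_complex_eq:
  "(lborel :: complex measure) = distr (lborel \<Otimes>\<^sub>M lborel) borel (\<lambda>p. Complex (fst p) (snd p))"
proof (rule lborel_eqI)
  fix l u :: complex
  assume le: "\<And>b. b \<in> Basis \<Longrightarrow> l \<bullet> b \<le> u \<bullet> b"
  then have le': "Re l \<le> Re u" "Im l \<le> Im u" using le[of 1] le[of \<i>]
    by (auto simp: Basis_complex_def inner_complex_def)
  have "(\<lambda>p. Complex (fst p) (snd p)) -` box l u = {Re l<..<Re u} \<times> {Im l<..<Im u}"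
    by (auto simp: mem_box Basis_complex_def inner_complex_def)
  then have "emeasure (distr (lborel \<Otimes>\<^sub>M lborel) borel (\<lambda>p. Complex (fst p) (snd p))) (box l u)
      = emeasure (lborel \<Otimes>\<^sub>M lborel) ({Re l<..<Re u} \<times> {Im l<..<Im u})"
    by (subst emeasure_distr) (auto simp: space_pair_measure)
  also have "\<dots> = ennreal (Re u - Re l) * ennreal (Im u - Im l)"
    using le' by (subst lborel.emeasure_pair_measure_Times) auto
  also have "\<dots> = ennreal (\<Prod>b\<in>Basis. (u - l) \<bullet> b)"
    using le' by (simp add: Basis_complex_def inner_complex_def ennreal_mult)
  finally show "emeasure (distr (lborel \<Otimes>\<^sub>M lborel) borel (\<lambda>p. Complex (fst p) (snd p))) (box l u)
      = (\<Prod>b\<in>Basis. (u - l) \<bullet> b)" .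
qed simp

text \<open>Links the iterated integral that defines the Bergman norm to integrals over the plane.\<close>

lemma nn_integral_complex_iterated:
  fixes h :: "complex \<Rightarrow> ennreal"
  assumes [measurable]: "h \<in> borel_measurable borel"
  shows "(\<integral>\<^sup>+z. h z \<partial>lborel) = (\<integral>\<^sup>+y. \<integral>\<^sup>+x. h (Complex x y) \<partial>lborel \<partial>lborel)"
proof -
  interpret lborel_pair: pair_sigma_finite "lborel :: real measure" "lborel :: real measure" ..
  have "(\<integral>\<^sup>+z. h z \<partial>lborel) = (\<integral>\<^sup>+p. h (Complex (fst p) (snd p)) \<partial>(lborel \<Otimes>\<^sub>M lborel))"
    by (subst lborel_complex_eq, subst nn_integral_distr) auto
  also have "\<dots> = (\<integral>\<^sup>+y. \<integral>\<^sup>+x. h (Complex (fst (x, y)) (snd (x, y))) \<partial>lborel \<partial>lborel)"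
    by (rule lborel_pair.nn_integral_snd[symmetric]) measurable
  finally show ?thesis by simp
qed

lemma sets_upper_half_plane [measurable]: "\<complex>\<^sub>+ \<in> sets borel"
  using open_upper_half_plane by auto

lemma borel_measurable_norm_powr_on:
  fixes g :: "complex \<Rightarrow> complex"
  assumes "continuous_on A g" and [measurable]: "A \<in> sets borel"
  shows "(\<lambda>z. ennreal (norm (g z) powr p) * indicator A z) \<in> borel_measurable borel"
proof -
  have [measurable]: "(\<lambda>z. indicator A z *\<^sub>R g z) \<in> borel_measurable borel"
    using assms by (intro borel_measurable_continuous_on_indicator) auto
  have "(\<lambda>z. ennreal (norm (indicator A z *\<^sub>R g z) powr p) * indicator A z) \<in> borel_measurable borel"
    by measurable
  also have "(\<lambda>z. ennreal (norm (indicator A z *\<^sub>R g z) powr p) * indicator A z)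
      = (\<lambda>z. ennreal (norm (g z) powr p) * indicator A z)"
    by (auto simp: indicator_def)
  finally show ?thesis .
qed

lemma borel_measurable_bergman_integrand:
  fixes g :: "complex \<Rightarrow> complex"
  assumes "continuous_on \<complex>\<^sub>+ g"
  shows "(\<lambda>z. ennreal (norm (g z) powr p * Im z powr \<alpha>) * indicator \<complex>\<^sub>+ z) \<in> borel_measurable borel"
proof -
  have [measurable]: "(\<lambda>z. ennreal (norm (g z) powr p) * indicator \<complex>\<^sub>+ z) \<in> borel_measurable borel"
    using assms by (intro borel_measurable_norm_powr_on) auto
  have [measurable]: "Im \<in> borel_measurable borel"
    by (intro borel_measurable_continuous_onI continuous_intros)
  have "(\<lambda>z. (ennreal (norm (g z) powr p) * indicator \<complex>\<^sub>+ z) * ennreal (Im z powr \<alpha>)) \<in> borel_measurable borel"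
    by measurable
  then show ?thesis by (simp add: ennreal_mult mult_ac)
qed

lemma bergman_space_iff:
  assumes p: "p > 0"
  shows "g \<in> bergman_space p \<alpha> \<longleftrightarrow> g holomorphic_on \<complex>\<^sub>+ \<and>
    (\<integral>\<^sup>+z\<in>\<complex>\<^sub>+. ennreal (norm (g z) powr p * Im z powr \<alpha>) \<partial>lborel) < \<infinity>"
proof (cases "g holomorphic_on \<complex>\<^sub>+")
  case True
  have "(\<integral>\<^sup>+z\<in>\<complex>\<^sub>+. ennreal (norm (g z) powr p * Im z powr \<alpha>) \<partial>lborel) =
    (\<integral>\<^sup>+y. \<integral>\<^sup>+x. ennreal (norm (g (Complex x y)) powr p * y powr \<alpha>) * indicator \<complex>\<^sub>+ (Complex x y) \<partial>lborel \<partial>lborel)"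
    using True by (subst nn_integral_complex_iterated)
      (auto intro: borel_measurable_bergman_integrand holomorphic_on_imp_continuous_on)
  also have "\<dots> = (\<integral>\<^sup>+y\<in>{0<..}. (\<integral>\<^sup>+x. ennreal (norm (g (Complex x y)) powr p * y powr \<alpha>) \<partial>lborel) \<partial>lborel)"
    by (intro nn_integral_cong) (auto simp: upper_half_plane_def indicator_def)
  finally show ?thesis
    using True by (auto simp: bergman_space_def bergman_norm_def ennreal_powr_def less_top)
qed (simp add: bergman_space_def)

text \<open>Powers of the height vary by a bounded factor on a hyperbolic ball of fixed size, whatever the
  sign of the exponent.\<close>

lemma powr_comparable:
  fixes y Y a :: real
  assumes "0 < y" "y / 2 \<le> Y" "Y \<le> 3 / 2 * y"
  shows "min ((1/2) powr a) ((3/2) powr a) * y powr a \<le> Y powr a"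
proof -
  have "min ((1/2) powr a) ((3/2) powr a) \<le> (Y / y) powr a"
  proof (cases "a \<ge> 0")
    case True
    then have "(1/2) powr a \<le> (Y / y) powr a" using assms by (intro powr_mono2) (auto simp: field_simps)
    then show ?thesis by simp
  next
    case False
    then have "(3/2) powr a \<le> (Y / y) powr a" using assms by (intro powr_mono2') (auto simp: field_simps)
    then show ?thesis by simp
  qed
  then show ?thesis using assms by (simp add: powr_divide field_simps)
qed

text \<open>By the relation between \<open>t\<close>, \<open>q\<close> and \<open>\<nu>\<close>, the quantity \<open>(\<bar>g w\<bar> (Im w)\<^bsup>t\<^esup>)\<^bsup>q\<^esup>\<close> is controlled by the
  Bergman mass of \<open>g\<close> on the hyperbolic ball around \<open>w\<close>, with a constant independent of \<open>w\<close>. Hence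
  each point of the superlevel set carries at least a fixed amount of a finite mass.\<close>

lemma bergman_space_vanishes_at_boundary:
  assumes q: "q > 0" and t: "t * q = \<nu> + 2" and d: "d > 0"
    and g: "g \<in> bergman_space q \<nu>"
  obtains R where "R > 0" "V_set d t g \<subseteq> window R"
proof -
  have hol: "g holomorphic_on \<complex>\<^sub>+"
    and fin: "(\<integral>\<^sup>+z\<in>\<complex>\<^sub>+. ennreal (norm (g z) powr q * Im z powr \<nu>) \<partial>lborel) < \<infinity>"
    using g q by (auto simp: bergman_space_iff)
  have cont: "continuous_on \<complex>\<^sub>+ g" using hol by (rule holomorphic_on_imp_continuous_on)
  obtain C where C: "C > 0" and Cle: "\<And>(g :: complex \<Rightarrow> complex) z r. \<lbrakk>0 < r; continuous_on (cball z r) g; g holomorphic_on ball z r\<rbrakk> \<Longrightarrow>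
      ennreal (C * (norm (g z) powr q * r\<^sup>2)) \<le> (\<integral>\<^sup>+w\<in>ball z r. ennreal (norm (g w) powr q) \<partial>lborel)"
    by (rule local_Lq_lower_bound[OF q]) (rule that, assumption+)
  define k :: real where "k = min ((1/2) powr \<nu>) ((3/2) powr \<nu>)"
  have k: "k > 0" by (simp add: k_def)
  define F where "F z = ennreal (norm (g z) powr q * Im z powr \<nu>) * indicator \<complex>\<^sub>+ z" for z
  define \<kappa> where "\<kappa> = k * C * d powr q / 4"
  show ?thesis
  proof (rule window_if_uniform_mass[where F = F and c = "1/2" and \<kappa> = "ennreal \<kappa>" and S = "V_set d t g"])
    show "F \<in> borel_measurable borel"
      unfolding F_def using cont by (rule borel_measurable_bergman_integrand)
    show "(\<integral>\<^sup>+z\<in>\<complex>\<^sub>+. F z \<partial>lborel) < \<infinity>"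
      using fin unfolding F_def by (simp add: mult.assoc flip: indicator_inter_arith)
    show "0 < ennreal \<kappa>" using k C d by (simp add: \<kappa>_def)
    show "V_set d t g \<subseteq> \<complex>\<^sub>+" by (auto simp: V_set_def)
    fix w assume w: "w \<in> V_set d t g"
    define y where "y = Im w"
    have y: "y > 0" and wC: "w \<in> \<complex>\<^sub>+" using w by (auto simp: V_set_def upper_half_plane_def y_def)
    have sub: "cball w (y / 2) \<subseteq> \<complex>\<^sub>+"
    proof
      fix u assume "u \<in> cball w (y / 2)"
      then have "\<bar>Im (w - u)\<bar> \<le> y / 2" using abs_Im_le_cmod[of "w - u"] by (simp add: dist_norm)
      then have "0 < Im u" using y unfolding y_def minus_complex.sel abs_le_iff by linarith
      then show "u \<in> \<complex>\<^sub>+" by (simp add: upper_half_plane_def)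
    qed
    have cont': "continuous_on (cball w (y / 2)) g" using cont sub continuous_on_subset by blast
    \<comment> \<open>The powers of \<open>y\<close> cancel: \<open>tq = \<nu> + 2\<close>, and \<open>2\<close> is the exponent of the area of the ball.\<close>
    have "d powr q \<le> (norm (g w) * y powr t) powr q"
      using w d q by (intro powr_mono2) (auto simp: V_set_def y_def)
    also have "\<dots> = norm (g w) powr q * y powr (\<nu> + 2)"
      using t by (simp add: powr_mult powr_powr)
    finally have "\<kappa> \<le> k * C * (norm (g w) powr q * y powr (\<nu> + 2)) / 4"
      unfolding \<kappa>_def using k C by (intro divide_right_mono mult_left_mono) auto
    also have "\<dots> = k * y powr \<nu> * (C * (norm (g w) powr q * (y / 2)\<^sup>2))"
      using y by (simp add: powr_add power2_eq_square)
    finally have "ennreal \<kappa> \<le> ennreal (k * y powr \<nu> * (C * (norm (g w) powr q * (y / 2)\<^sup>2)))"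
      by (rule ennreal_leI)
    also have "\<dots> = ennreal (k * y powr \<nu>) * ennreal (C * (norm (g w) powr q * (y / 2)\<^sup>2))"
      using k by (intro ennreal_mult') auto
    also have "\<dots> \<le> ennreal (k * y powr \<nu>) * (\<integral>\<^sup>+u\<in>ball w (y / 2). ennreal (norm (g u) powr q) \<partial>lborel)"
      using y cont' sub by (intro mult_left_mono Cle holomorphic_on_subset[OF hol]) auto
    also have "\<dots> = (\<integral>\<^sup>+u. ennreal (k * y powr \<nu>) * (ennreal (norm (g u) powr q) * indicator (ball w (y / 2)) u) \<partial>lborel)"
      using borel_measurable_norm_powr_on[OF continuous_on_subset[OF cont' ball_subset_cball], of q]
      by (simp add: nn_integral_cmult)
    also have "\<dots> \<le> (\<integral>\<^sup>+u\<in>ball w (1/2 * Im w). F u \<partial>lborel)"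
    proof (intro nn_integral_mono)
      fix u
      show "ennreal (k * y powr \<nu>) * (ennreal (norm (g u) powr q) * indicator (ball w (y / 2)) u)
        \<le> F u * indicator (ball w (1/2 * Im w)) u"
      proof (cases "u \<in> ball w (y / 2)")
        case True
        then have u: "u \<in> ball w (1/2 * Im w)" by (simp add: y_def)
        have "k * y powr \<nu> \<le> Im u powr \<nu>"
          unfolding k_def using y Im_bounds_hyperbolic_ball[OF u] by (intro powr_comparable) (auto simp: y_def)
        then have "k * y powr \<nu> * norm (g u) powr q \<le> norm (g u) powr q * Im u powr \<nu>"
          by (subst mult.commute) (intro mult_left_mono, auto)
        moreover have "u \<in> \<complex>\<^sub>+" using sub True by auto
        ultimately show ?thesis using True u k
          by (auto simp: F_def simp flip: ennreal_mult' intro!: ennreal_leI)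
      qed simp
    qed
    finally show "ennreal \<kappa> \<le> (\<integral>\<^sup>+u\<in>ball w (1/2 * Im w). F u \<partial>lborel)" .
  qed (use that in auto)
qed

section \<open>Finite kernel integrals force compact superlevel sets\<close>

definition kernel_integral :: "real \<Rightarrow> real \<Rightarrow> complex set \<Rightarrow> complex \<Rightarrow> ennreal" where
  "kernel_integral a b V z = (\<integral>\<^sup>+w\<in>V. ennreal (Im w powr a / norm (cnj w - z) powr b) \<partial>lborel)"

lemma ennreal_powr_ennreal: "0 \<le> x \<Longrightarrow> ennreal_powr (ennreal x) q = ennreal (x powr q)"
  by (simp add: ennreal_powr_def)

lemma ennreal_powr_mono:
  assumes "q \<ge> 0" "x \<le> y" shows "ennreal_powr x q \<le> ennreal_powr y q"
  using assms by (cases x; cases y) (auto simp: ennreal_powr_def top_unique intro!: ennreal_leI powr_mono2)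

lemma borel_measurable_ennreal_powr [measurable]:
  "(\<lambda>x. ennreal_powr x q) \<in> borel_measurable borel"
  unfolding ennreal_powr_def by measurable

lemma sets_V_set:
  assumes "f holomorphic_on \<complex>\<^sub>+" shows "V_set \<epsilon> t f \<in> sets borel"
proof -
  have [measurable]: "(\<lambda>z. indicator \<complex>\<^sub>+ z *\<^sub>R f z) \<in> borel_measurable borel"
    using assms by (intro borel_measurable_continuous_on_indicator holomorphic_on_imp_continuous_on) auto
  have [measurable]: "Im \<in> borel_measurable borel"
    by (intro borel_measurable_continuous_onI continuous_intros)
  have "{z \<in> space borel. z \<in> \<complex>\<^sub>+ \<and> norm (indicator \<complex>\<^sub>+ z *\<^sub>R f z) * Im z powr t \<ge> \<epsilon>} \<in> sets borel"
    by measurable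
  also have "{z \<in> space borel. z \<in> \<complex>\<^sub>+ \<and> norm (indicator \<complex>\<^sub>+ z *\<^sub>R f z) * Im z powr t \<ge> \<epsilon>} = V_set \<epsilon> t f"
    by (auto simp: V_set_def)
  finally show ?thesis .
qed

lemma borel_measurable_kernel_integral [measurable]:
  assumes [measurable]: "V \<in> sets borel"
  shows "kernel_integral a b V \<in> borel_measurable borel"
proof -
  have [measurable]: "Im \<in> borel_measurable borel" "cnj \<in> borel_measurable borel"
    by (intro borel_measurable_continuous_onI continuous_intros)+
  have "(\<lambda>z. \<integral>\<^sup>+w\<in>V. ennreal (Im w powr a / norm (cnj w - z) powr b) \<partial>lborel) \<in> borel_measurable borel"
    by measurable
  then show ?thesis by (simp add: kernel_integral_def[abs_def])
qed

text \<open>The growth bound makes \<open>\<bar>f z\<bar> (Im z)\<^bsup>t\<^esup>\<close> uniformly continuous in the hyperbolic metric, so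
  lowering the level by \<open>\<eta>\<close> thickens the superlevel set by hyperbolic balls of a fixed size.\<close>

lemma growth_super_level_ball:
  fixes f :: "complex \<Rightarrow> complex"
  assumes hol: "f holomorphic_on \<complex>\<^sub>+"
    and M: "\<And>z. z \<in> \<complex>\<^sub>+ \<Longrightarrow> norm (f z) * Im z powr t \<le> M"
    and t: "t > 0" and \<eta>: "\<eta> > 0"
  obtains c where "0 < c" "c \<le> 1/4"
    "\<And>w. w \<in> V_set (\<epsilon> + \<eta>) t f \<Longrightarrow> ball w (c * Im w) \<subseteq> V_set \<epsilon> t f"
proof -
  \<comment> \<open>The expression is the lower bound for \<open>\<bar>f u\<bar> (Im u)\<^bsup>t\<^esup>\<close> on the ball that is derived below.\<close>
  have "((\<lambda>c. (1 - c) powr t * (\<epsilon> + \<eta> - 8 * c * (M * 2 powr t))) \<longlongrightarrow>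
      (1 - 0) powr t * (\<epsilon> + \<eta> - 8 * 0 * (M * 2 powr t))) (at_right 0)"
    by (intro tendsto_intros) auto
  then have "\<forall>\<^sub>F c in at_right 0. (1 - c) powr t * (\<epsilon> + \<eta> - 8 * c * (M * 2 powr t)) > \<epsilon>"
    using \<eta> by (intro order_tendstoD(1)) auto
  moreover have "\<forall>\<^sub>F c in at_right 0. c \<in> {0<..<1/4::real}"
    by (intro eventually_at_right_real) auto
  ultimately have "\<forall>\<^sub>F c in at_right 0. c \<in> {0<..<1/4} \<and> (1 - c) powr t * (\<epsilon> + \<eta> - 8 * c * (M * 2 powr t)) > \<epsilon>"
    by eventually_elim auto
  then obtain c where c: "0 < c" "c < 1/4" and c\<epsilon>: "(1 - c) powr t * (\<epsilon> + \<eta> - 8 * c * (M * 2 powr t)) > \<epsilon>"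
    using eventually_happens'[OF trivial_limit_at_right_real] by auto
  show ?thesis
  proof (rule that)
    fix w assume w: "w \<in> V_set (\<epsilon> + \<eta>) t f"
    define y where "y = Im w"
    have wC: "w \<in> \<complex>\<^sub>+" and y: "y > 0" and fw: "\<epsilon> + \<eta> \<le> norm (f w) * y powr t"
      using w by (auto simp: V_set_def upper_half_plane_def y_def)
    have half: "ball w (1/2 * Im w) \<subseteq> \<complex>\<^sub>+" using wC by (intro hyperbolic_ball_subset) auto
    have B: "norm (f u) \<le> M * 2 powr t * y powr (- t)" if u: "u \<in> ball w (1/2 * Im w)" for u
    proof -
      have "u \<in> \<complex>\<^sub>+" using half u by auto
      moreover have "(y / 2) powr t \<le> Im u powr t"
        using Im_bounds_hyperbolic_ball(1)[OF u] y t by (intro powr_mono2) (auto simp: y_def)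
      ultimately have "norm (f u) * (y / 2) powr t \<le> M"
        using M[of u] by (meson mult_left_mono norm_ge_zero order_trans)
      then show ?thesis using y by (simp add: powr_divide powr_minus field_simps)
    qed
    show "ball w (c * Im w) \<subseteq> V_set \<epsilon> t f"
    proof
      fix u assume u: "u \<in> ball w (c * Im w)"
      have sub: "ball w (c * Im w) \<subseteq> \<complex>\<^sub>+" using wC c by (intro hyperbolic_ball_subset) auto
      have "norm (f u - f w) \<le> 4 * (M * 2 powr t * y powr (- t)) / (1/2 * Im w) * norm (u - w)"
      proof (rule holomorphic_lipschitz_half_ball[OF holomorphic_on_subset[OF hol half] B])
        have "c * Im w < 1/2 * Im w / 2" using c y by (simp add: y_def)
        then show "u \<in> ball w (1/2 * Im w / 2)" using u by simp
      qed
      also have "\<dots> \<le> 4 * (M * 2 powr t * y powr (- t)) / (1/2 * Im w) * (c * y)"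
      proof (intro mult_left_mono)
        show "norm (u - w) \<le> c * y" using u by (simp add: y_def dist_norm norm_minus_commute)
        have "0 \<le> M * 2 powr t * y powr - t"
          using B[of w] y order_trans[OF norm_ge_zero] by (auto simp: y_def)
        then show "0 \<le> 4 * (M * 2 powr t * y powr (- t)) / (1/2 * Im w)" using y by (simp add: y_def)
      qed
      also have "\<dots> = 8 * c * (M * 2 powr t) * y powr (- t)" using y by (simp add: y_def)
      finally have "norm (f w) - 8 * c * (M * 2 powr t) * y powr (- t) \<le> norm (f u)"
        using norm_triangle_ineq2[of "f w" "f u"] by (simp add: norm_minus_commute)
      moreover have "(\<epsilon> + \<eta>) * y powr (- t) \<le> norm (f w)"
        using fw y by (simp add: powr_minus field_simps)
      ultimately have fu: "(\<epsilon> + \<eta> - 8 * c * (M * 2 powr t)) * y powr (- t) \<le> norm (f u)"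
        by (simp add: left_diff_distrib)
      have "\<epsilon> < (1 - c) powr t * (\<epsilon> + \<eta> - 8 * c * (M * 2 powr t))" by (fact c\<epsilon>)
      also have "\<dots> = (\<epsilon> + \<eta> - 8 * c * (M * 2 powr t)) * y powr (- t) * ((1 - c) * y) powr t"
      proof -
        have "y powr (- t) * ((1 - c) * y) powr t = (1 - c) powr t"
          using y c by (simp add: powr_mult powr_minus)
        then show ?thesis by (metis mult.assoc mult.commute)
      qed
      also have "\<dots> \<le> norm (f u) * ((1 - c) * y) powr t"
        using fu by (intro mult_right_mono) auto
      also have "\<dots> \<le> norm (f u) * Im u powr t"
        using Im_bounds_hyperbolic_ball(1)[OF u] c y t by (intro mult_left_mono powr_mono2) (auto simp: y_def)
      finally show "u \<in> V_set \<epsilon> t f" using u sub by (auto simp: V_set_def)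
    qed
  qed (use c in auto)
qed

text \<open>For two points of the ball of radius \<open>c (Im w)\<close> around \<open>w\<close>, the distance \<open>\<bar>cnj v - z\<bar>\<close> is
  comparable to \<open>Im w\<close>; the exponent counts the weight, the kernel and the area of the ball.\<close>

lemma kernel_integral_lower_bound:
  assumes c: "0 < c" "c \<le> 1/4" and b: "b \<ge> 0"
  obtains \<kappa> where "\<kappa> > 0"
    "\<And>V w z. \<lbrakk>w \<in> \<complex>\<^sub>+; ball w (c * Im w) \<subseteq> V; z \<in> ball w (c * Im w)\<rbrakk> \<Longrightarrow>
       ennreal (\<kappa> * Im w powr (a - b + 2)) \<le> kernel_integral a b V z"
proof -
  define k :: real where "k = min ((1/2) powr a) ((3/2) powr a)"
  have k: "k > 0" by (simp add: k_def)
  define \<kappa> where "\<kappa> = k * 4 powr (- b) * (pi * c\<^sup>2)"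
  have "\<kappa> > 0" using k c by (simp add: \<kappa>_def)
  moreover have "ennreal (\<kappa> * Im w powr (a - b + 2)) \<le> kernel_integral a b V z"
    if w: "w \<in> \<complex>\<^sub>+" and sub: "ball w (c * Im w) \<subseteq> V" and z: "z \<in> ball w (c * Im w)" for V w z
  proof -
    define y where "y = Im w"
    have y: "y > 0" using w by (simp add: y_def upper_half_plane_def)
    have cy: "c * y \<le> 1/4 * y" using c y by (intro mult_right_mono) auto
    have bound: "k * y powr a / (4 * y) powr b \<le> Im v powr a / norm (cnj v - z) powr b"
      if v: "v \<in> ball w (c * Im w)" for v
    proof (rule frac_le)
      have v': "v \<in> ball w (1/2 * Im w)" and z': "z \<in> ball w (1/2 * Im w)"
        using v z cy y unfolding mem_ball y_def by linarith+
      show "k * y powr a \<le> Im v powr a"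
        unfolding k_def using y Im_bounds_hyperbolic_ball[OF v'] by (intro powr_comparable) (auto simp: y_def)
      have pos: "Im v > 0" "Im z > 0" using Im_bounds_hyperbolic_ball(1)[OF v'] Im_bounds_hyperbolic_ball(1)[OF z'] y by (auto simp: y_def)
      have "cnj v - z \<noteq> 0"
      proof
        assume "cnj v - z = 0"
        then have "Im (cnj v - z) = 0" by simp
        then show False using pos by simp
      qed
      then show "0 < norm (cnj v - z) powr b" by simp
      have "norm (cnj v - z) \<le> norm (cnj v - cnj w) + norm (cnj w - w) + norm (w - z)"
        using norm_triangle_ineq[of "cnj v - cnj w" "cnj w - w"]
          norm_triangle_ineq[of "(cnj v - cnj w) + (cnj w - w)" "w - z"] by simp
      moreover have "norm (cnj v - cnj w) = norm (v - w)"
        by (metis complex_cnj_diff complex_mod_cnj)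
      moreover have "norm (cnj w - w) = 2 * y"
      proof -
        have "cnj w - w = Complex 0 (- 2 * y)" by (simp add: complex_eq_iff y_def)
        then show ?thesis using y by (simp add: complex_norm real_sqrt_mult)
      qed
      moreover have "norm (v - w) < c * y" "norm (w - z) < c * y"
        using v z by (auto simp: dist_norm norm_minus_commute y_def)
      ultimately have "norm (cnj v - z) \<le> 4 * y" using cy y by linarith
      then show "norm (cnj v - z) powr b \<le> (4 * y) powr b"
        using b by (intro powr_mono2) auto
    qed auto
    have "\<kappa> * y powr (a - b + 2) = k * y powr a / (4 * y) powr b * (pi * (c * y)\<^sup>2)"
      using y by (simp add: \<kappa>_def powr_mult powr_add powr_diff powr_minus field_simps power2_eq_square)
    then have "ennreal (\<kappa> * y powr (a - b + 2)) = ennreal (k * y powr a / (4 * y) powr b * (pi * (c * y)\<^sup>2))"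
      by (simp only:)
    also have "\<dots> = ennreal (k * y powr a / (4 * y) powr b) * ennreal (pi * (c * y)\<^sup>2)"
      using k by (intro ennreal_mult') auto
    also have "\<dots> = (\<integral>\<^sup>+v\<in>ball w (c * Im w). ennreal (k * y powr a / (4 * y) powr b) \<partial>lborel)"
      using c y by (simp add: nn_integral_cmult_indicator emeasure_complex_ball y_def)
    also have "\<dots> \<le> kernel_integral a b V z"
      unfolding kernel_integral_def
    proof (intro nn_integral_mono)
      fix v
      show "ennreal (k * y powr a / (4 * y) powr b) * indicator (ball w (c * Im w)) v
         \<le> ennreal (Im v powr a / norm (cnj v - z) powr b) * indicator V v"
        using bound[of v] sub by (auto simp: indicator_def intro!: ennreal_leI)
    qed
    finally show ?thesis by (simp add: y_def)
  qed
  ultimately show ?thesis by (rule that)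
qed

text \<open>Each point of the higher superlevel set is the centre of a hyperbolic ball inside the lower
  one. On that ball the inner integral is at least a multiple of \<open>(Im w)\<^bsup>-t\<^esup>\<close>, so the outer integrand
  is at least a multiple of \<open>(Im w)\<^bsup>-2\<^esup>\<close>, because \<open>tq = \<nu> + 2\<close>. Every such ball thus contributes a
  fixed amount to the finite outer integral.\<close>

lemma V_set_window_if_integral_finite:
  fixes f :: "complex \<Rightarrow> complex"
  assumes hol: "f holomorphic_on \<complex>\<^sub>+"
    and M: "\<And>z. z \<in> \<complex>\<^sub>+ \<Longrightarrow> norm (f z) * Im z powr t \<le> M"
    and q: "q > 0" and t: "t * q = \<nu> + 2" "t > 0" and \<beta>: "\<beta> \<ge> - 2" and \<eta>: "\<eta> > 0"
    and fin: "(\<integral>\<^sup>+z\<in>\<complex>\<^sub>+. (ennreal_powr (kernel_integral (\<beta> - t) (\<beta> + 2) (V_set \<epsilon> t f) z) q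
           * ennreal (Im z powr \<nu>)) \<partial>lborel) < \<infinity>"
  obtains R where "R > 0" "V_set (\<epsilon> + \<eta>) t f \<subseteq> window R"
proof -
  obtain c where c: "0 < c" "c \<le> 1/4" and cV: "\<And>w. w \<in> V_set (\<epsilon> + \<eta>) t f \<Longrightarrow> ball w (c * Im w) \<subseteq> V_set \<epsilon> t f"
    by (rule growth_super_level_ball[OF hol _ t(2) \<eta>, of M \<epsilon>]) (rule M, assumption, rule that, assumption+)
  obtain \<kappa> where \<kappa>: "\<kappa> > 0" and low: "\<And>V w z. \<lbrakk>w \<in> \<complex>\<^sub>+; ball w (c * Im w) \<subseteq> V; z \<in> ball w (c * Im w)\<rbrakk> \<Longrightarrow>
       ennreal (\<kappa> * Im w powr (\<beta> - t - (\<beta> + 2) + 2)) \<le> kernel_integral (\<beta> - t) (\<beta> + 2) V z"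
    by (rule kernel_integral_lower_bound[OF c, of "\<beta> + 2" "\<beta> - t"]) (use \<beta> in simp, rule that, assumption+)
  define k :: real where "k = min ((1/2) powr \<nu>) ((3/2) powr \<nu>)"
  have k: "k > 0" by (simp add: k_def)
  define F where "F z = ennreal_powr (kernel_integral (\<beta> - t) (\<beta> + 2) (V_set \<epsilon> t f) z) q
           * ennreal (Im z powr \<nu>)" for z
  have [measurable]: "Im \<in> borel_measurable borel" "V_set \<epsilon> t f \<in> sets borel"
    using hol by (auto intro: borel_measurable_continuous_onI continuous_intros sets_V_set)
  show ?thesis
  proof (rule window_if_uniform_mass[where F = F and c = c and \<kappa> = "ennreal (\<kappa> powr q * k * (pi * c\<^sup>2))" and S = "V_set (\<epsilon> + \<eta>) t f"])
    show "F \<in> borel_measurable borel" unfolding F_def by measurable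
    show "(\<integral>\<^sup>+z\<in>\<complex>\<^sub>+. F z \<partial>lborel) < \<infinity>" using fin by (simp add: F_def)
    show "c \<le> 1/2" using c by simp
    show "0 < ennreal (\<kappa> powr q * k * (pi * c\<^sup>2))" using k \<kappa> c by simp
    show "V_set (\<epsilon> + \<eta>) t f \<subseteq> \<complex>\<^sub>+" by (auto simp: V_set_def)
    fix w assume w: "w \<in> V_set (\<epsilon> + \<eta>) t f"
    define y where "y = Im w"
    have y: "y > 0" and wC: "w \<in> \<complex>\<^sub>+" using w by (auto simp: V_set_def upper_half_plane_def y_def)
    have bound: "ennreal (\<kappa> powr q * k * y powr (-2)) \<le> F z" if z: "z \<in> ball w (c * Im w)" for z
    proof -
      have "c * Im w \<le> 1/2 * Im w" using c y unfolding y_def by (intro mult_right_mono) auto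
      then have z': "z \<in> ball w (1/2 * Im w)" using z by simp
      have "ennreal (\<kappa> * y powr (- t)) \<le> kernel_integral (\<beta> - t) (\<beta> + 2) (V_set \<epsilon> t f) z"
        using low[OF wC cV[OF w] z] by (simp add: y_def)
      then have "ennreal_powr (ennreal (\<kappa> * y powr (- t))) q \<le> ennreal_powr (kernel_integral (\<beta> - t) (\<beta> + 2) (V_set \<epsilon> t f) z) q"
        using q by (intro ennreal_powr_mono) auto
      moreover have "(\<kappa> * y powr (- t)) powr q = \<kappa> powr q * y powr (- \<nu> - 2)"
        using \<kappa> t by (simp add: powr_mult powr_powr)
      ultimately have 1: "ennreal (\<kappa> powr q * y powr (- \<nu> - 2)) \<le> ennreal_powr (kernel_integral (\<beta> - t) (\<beta> + 2) (V_set \<epsilon> t f) z) q"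
        using \<kappa> by (simp add: ennreal_powr_ennreal)
      have 2: "ennreal (k * y powr \<nu>) \<le> ennreal (Im z powr \<nu>)"
        unfolding k_def using y Im_bounds_hyperbolic_ball[OF z'] by (intro ennreal_leI powr_comparable) (auto simp: y_def)
      have "y powr (-2) = y powr (- \<nu> - 2) * y powr \<nu>" by (simp flip: powr_add)
      then have "ennreal (\<kappa> powr q * k * y powr (-2)) = ennreal (\<kappa> powr q * y powr (- \<nu> - 2)) * ennreal (k * y powr \<nu>)"
        using k by (simp add: mult_ac flip: ennreal_mult')
      also have "\<dots> \<le> F z" unfolding F_def by (rule mult_mono[OF 1 2]) auto
      finally show ?thesis .
    qed
    have "\<kappa> powr q * k * (pi * c\<^sup>2) = \<kappa> powr q * k * y powr (-2) * (pi * (c * y)\<^sup>2)"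
      using y by (simp add: powr_minus power2_eq_square field_simps)
    then have "ennreal (\<kappa> powr q * k * (pi * c\<^sup>2)) = ennreal (\<kappa> powr q * k * y powr (-2) * (pi * (c * y)\<^sup>2))"
      by (simp only:)
    also have "\<dots> = ennreal (\<kappa> powr q * k * y powr (-2)) * ennreal (pi * (c * y)\<^sup>2)"
      using k by (intro ennreal_mult') auto
    also have "\<dots> = (\<integral>\<^sup>+v\<in>ball w (c * Im w). ennreal (\<kappa> powr q * k * y powr (-2)) \<partial>lborel)"
      using c y by (simp add: nn_integral_cmult_indicator emeasure_complex_ball y_def)
    also have "\<dots> \<le> (\<integral>\<^sup>+z\<in>ball w (c * Im w). F z \<partial>lborel)"
      using bound by (intro nn_integral_mono) (auto simp: indicator_def)
    finally show "ennreal (\<kappa> powr q * k * (pi * c\<^sup>2)) \<le> (\<integral>\<^sup>+z\<in>ball w (c * Im w). F z \<partial>lborel)" .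
  qed (rule that, assumption+)
qed

section \<open>Compact superlevel sets have finite kernel integrals\<close>

lemma nn_integral_half_line_powr_finite:
  fixes a b :: real
  assumes a: "a > -1" and b: "b > a + 1"
  shows "(\<integral>\<^sup>+y. ennreal (indicator {0<..} y * ((1 + y) powr (- b) * y powr a)) \<partial>lborel) < \<infinity>"
proof -
  have near: "(\<integral>\<^sup>+y. ennreal (indicator {0..1} y * y powr a) \<partial>lborel) < \<infinity>"
    using nn_integral_has_integral_lebesgue[OF _ has_integral_powr_from_0[OF a, of 1]] by simp
  have far: "(\<integral>\<^sup>+y. ennreal (indicator {1..} y * y powr (a - b)) \<partial>lborel) < \<infinity>"
    using nn_integral_has_integral_lebesgue[OF _ has_integral_powr_to_inf[of "a - b" 1]] b by simp
  have "(\<integral>\<^sup>+y. ennreal (indicator {0<..} y * ((1 + y) powr (- b) * y powr a)) \<partial>lborel)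
    \<le> (\<integral>\<^sup>+y. ennreal (indicator {0..1} y * y powr a) + ennreal (indicator {1..} y * y powr (a - b)) \<partial>lborel)"
  proof (intro nn_integral_mono)
    fix y :: real
    have 1: "(1 + y) powr (- b) * y powr a \<le> y powr a" if "0 < y"
    proof -
      have "(1 + y) powr (- b) \<le> 1 powr (- b)" using that a b by (intro powr_mono2') auto
      then show ?thesis by (simp add: mult_left_le_one_le)
    qed
    have 2: "(1 + y) powr (- b) * y powr a \<le> y powr (a - b)" if "1 < y"
    proof -
      have "(1 + y) powr (- b) \<le> y powr (- b)" using that a b by (intro powr_mono2') auto
      then have "(1 + y) powr (- b) * y powr a \<le> y powr (- b) * y powr a" by (intro mult_right_mono) auto
      then show ?thesis by (simp flip: powr_add)
    qed
    consider "y \<le> 0" | "0 < y" "y \<le> 1" | "1 < y" by linarith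
    then show "ennreal (indicator {0<..} y * ((1 + y) powr (- b) * y powr a))
       \<le> ennreal (indicator {0..1} y * y powr a) + ennreal (indicator {1..} y * y powr (a - b))"
      by cases (use 1 2 in \<open>auto intro!: ennreal_leI simp: indicator_def add_increasing2\<close>)
  qed
  also have "\<dots> = (\<integral>\<^sup>+y. ennreal (indicator {0..1} y * y powr a) \<partial>lborel) + (\<integral>\<^sup>+y. ennreal (indicator {1..} y * y powr (a - b)) \<partial>lborel)"
    by (rule nn_integral_add) auto
  also have "\<dots> < \<infinity>" using near far by simp
  finally show ?thesis .
qed

lemma nn_integral_line_powr_finite:
  fixes a :: real
  assumes a: "a > 1"
  shows "(\<integral>\<^sup>+x. ennreal ((1 + \<bar>x\<bar>) powr (- a)) \<partial>lborel) < \<infinity>"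
proof -
  define G :: "real \<Rightarrow> ennreal" where "G x = ennreal (indicator {0<..} x * ((1 + x) powr (- a) * x powr 0))" for x
  have [measurable]: "G \<in> borel_measurable borel" unfolding G_def by measurable
  have G: "(\<integral>\<^sup>+x. G x \<partial>lborel) < \<infinity>"
    unfolding G_def using a by (intro nn_integral_half_line_powr_finite) auto
  have "(\<integral>\<^sup>+x. ennreal ((1 + \<bar>x\<bar>) powr (- a)) \<partial>lborel) = (\<integral>\<^sup>+x. G x + G (0 + (-1) * x) \<partial>lborel)"
  proof (rule nn_integral_cong_AE)
    show "AE x in lborel. ennreal ((1 + \<bar>x\<bar>) powr (- a)) = G x + G (0 + (-1) * x)"
      using AE_lborel_singleton[of 0] by eventually_elim (auto simp: G_def indicator_def)
  qed
  also have "\<dots> = (\<integral>\<^sup>+x. G x \<partial>lborel) + (\<integral>\<^sup>+x. G (0 + (-1) * x) \<partial>lborel)"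
    by (rule nn_integral_add) measurable
  also have "(\<integral>\<^sup>+x. G (0 + (-1) * x) \<partial>lborel) = (\<integral>\<^sup>+x. G x \<partial>lborel)"
    by (subst nn_integral_real_affine[of G "-1" 0]) auto
  finally show ?thesis using G by simp
qed

text \<open>The surplus \<open>s - (\<nu> + 2)\<close> is shared equally between the two coordinates, which reduces the
  claim to a product of one-dimensional integrals.\<close>

lemma nn_integral_upper_half_plane_decay_finite:
  fixes \<nu> s :: real
  assumes \<nu>: "\<nu> > -1" and s: "s > \<nu> + 2"
  shows "(\<integral>\<^sup>+z\<in>\<complex>\<^sub>+. ennreal ((1 + norm z) powr (- s) * Im z powr \<nu>) \<partial>lborel) < \<infinity>"
proof -
  define \<delta> where "\<delta> = (s - \<nu> - 2) / 2"
  have \<delta>: "\<delta> > 0" "s = (1 + \<delta>) + (\<nu> + 1 + \<delta>)" using s by (auto simp: \<delta>_def)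
  define H :: "real \<Rightarrow> ennreal" where "H x = ennreal ((1 + \<bar>x\<bar>) powr (- (1 + \<delta>)))" for x
  define G :: "real \<Rightarrow> ennreal" where "G y = ennreal (indicator {0<..} y * ((1 + y) powr (- (\<nu> + 1 + \<delta>)) * y powr \<nu>))" for y
  have [measurable]: "G \<in> borel_measurable borel" "H \<in> borel_measurable borel"
    unfolding G_def H_def by measurable
  have [measurable]: "Im \<in> borel_measurable borel" "Re \<in> borel_measurable borel"
    by (intro borel_measurable_continuous_onI continuous_intros)+
  have H: "(\<integral>\<^sup>+x. H x \<partial>lborel) < \<infinity>"
    unfolding H_def using \<delta> by (intro nn_integral_line_powr_finite) auto
  have G: "(\<integral>\<^sup>+x. G x \<partial>lborel) < \<infinity>"
    unfolding G_def using \<delta> \<nu> by (intro nn_integral_half_line_powr_finite) auto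
  have "(\<integral>\<^sup>+z\<in>\<complex>\<^sub>+. ennreal ((1 + norm z) powr (- s) * Im z powr \<nu>) \<partial>lborel)
      \<le> (\<integral>\<^sup>+z. G (Im z) * H (Re z) \<partial>lborel)"
  proof (intro nn_integral_mono)
    fix z :: complex
    show "ennreal ((1 + norm z) powr (- s) * Im z powr \<nu>) * indicator \<complex>\<^sub>+ z \<le> G (Im z) * H (Re z)"
    proof (cases "z \<in> \<complex>\<^sub>+")
      case True
      then have y: "Im z > 0" by (simp add: upper_half_plane_def)
      have "(1 + norm z) powr (- s) = (1 + norm z) powr (- (\<nu> + 1 + \<delta>)) * (1 + norm z) powr (- (1 + \<delta>))"
      proof -
        have "- s = - (\<nu> + 1 + \<delta>) + - (1 + \<delta>)" using \<delta>(2) by simp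
        then show ?thesis by (simp only: powr_add)
      qed
      also have "\<dots> \<le> (1 + Im z) powr (- (\<nu> + 1 + \<delta>)) * (1 + \<bar>Re z\<bar>) powr (- (1 + \<delta>))"
        using y \<delta> \<nu> abs_Im_le_cmod[of z] abs_Re_le_cmod[of z]
        by (intro mult_mono powr_mono2') auto
      finally have "(1 + norm z) powr (- s) * Im z powr \<nu>
         \<le> ((1 + Im z) powr (- (\<nu> + 1 + \<delta>)) * (1 + \<bar>Re z\<bar>) powr (- (1 + \<delta>))) * Im z powr \<nu>"
        by (intro mult_right_mono) auto
      then have "(1 + norm z) powr (- s) * Im z powr \<nu>
         \<le> (1 + Im z) powr (- (\<nu> + 1 + \<delta>)) * Im z powr \<nu> * (1 + \<bar>Re z\<bar>) powr (- (1 + \<delta>))"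
        by (simp only: mult_ac)
      then show ?thesis using True y
        by (auto simp: G_def H_def simp flip: ennreal_mult' intro!: ennreal_leI)
    qed simp
  qed
  also have "\<dots> = (\<integral>\<^sup>+y. \<integral>\<^sup>+x. G y * H x \<partial>lborel \<partial>lborel)"
    by (subst nn_integral_complex_iterated) auto
  also have "\<dots> = (\<integral>\<^sup>+y. G y \<partial>lborel) * (\<integral>\<^sup>+x. H x \<partial>lborel)"
    by (simp add: nn_integral_cmult nn_integral_multc)
  also have "\<dots> < \<infinity>" using G H by (simp add: ennreal_mult_less_top)
  finally show ?thesis .
qed

text \<open>For \<open>w\<close> in a compact set, \<open>\<bar>cnj w - z\<bar>\<close> is at least a multiple of \<open>1 + \<bar>z\<bar>\<close>, so the inner
  integral decays like \<open>(1 + \<bar>z\<bar>)\<^bsup>-b\<^esup>\<close>, and \<open>bq > \<nu> + 2\<close> is exactly what makes the outer integral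
  converge. In the theorem, \<open>b = \<beta> + 2\<close>, and this is the lower bound on \<open>\<beta>\<close>.\<close>

lemma integral_finite_if_window:
  assumes V: "V \<subseteq> window R" and R: "R > 0" and q: "q > 0" and \<nu>: "\<nu> > -1" and b: "b * q > \<nu> + 2"
  shows "(\<integral>\<^sup>+z\<in>\<complex>\<^sub>+. (ennreal_powr (kernel_integral a b V z) q * ennreal (Im z powr \<nu>)) \<partial>lborel) < \<infinity>"
proof -
  have b0: "b > 0"
  proof -
    have "0 < b * q" using b \<nu> by linarith
    then show ?thesis using q by (simp add: zero_less_mult_iff)
  qed
  define L where "L = 1 + R + R * R"
  have L: "L > 0" using R by (simp add: L_def add_pos_pos)
  have dist: "1 + norm z \<le> L * norm (cnj w - z)" if w: "w \<in> window R" and z: "z \<in> \<complex>\<^sub>+" for w z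
  proof -
    define d where "d = norm (cnj w - z)"
    have "1 / R \<le> Im w + Im z" using w z by (simp add: window_def upper_half_plane_def)
    also have "\<dots> \<le> d" using abs_Im_le_cmod[of "cnj w - z"] by (simp add: d_def)
    finally have 1: "1 \<le> R * d" using R by (simp add: field_simps)
    have "norm z \<le> norm (cnj w) + d"
      unfolding d_def by (metis norm_minus_commute norm_triangle_sub)
    also have "norm (cnj w) \<le> R * 1" using w by (simp add: window_def)
    also have "R * 1 \<le> R * (R * d)" using 1 R by (intro mult_left_mono) auto
    finally show ?thesis using 1 by (simp add: L_def d_def[symmetric] algebra_simps)
  qed
  define P where "P = R powr \<bar>a\<bar>"
  have P: "Im w powr a \<le> P" if w: "w \<in> window R" for w
  proof -
    have 1: "1 / R \<le> Im w" "Im w \<le> R"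
      using w abs_Im_le_cmod[of w] by (auto simp: window_def)
    show ?thesis
    proof (cases "a \<ge> 0")
      case True
      then show ?thesis using 1 R order_trans[of 0 "1 / R" "Im w"] by (auto simp: P_def intro!: powr_mono2)
    next
      case False
      then have "Im w powr a \<le> (1 / R) powr a" using 1 R by (intro powr_mono2') auto
      then show ?thesis using R False by (simp add: P_def powr_divide powr_minus_divide)
    qed
  qed
  define A where "A = P * L powr b * measure lborel (cball (0::complex) R)"
  have A: "A \<ge> 0" by (simp add: A_def P_def)
  have kernel: "kernel_integral a b V z \<le> ennreal (A * (1 + norm z) powr (- b))" if z: "z \<in> \<complex>\<^sub>+" for z
  proof -
    have "kernel_integral a b V z \<le> (\<integral>\<^sup>+w\<in>cball (0::complex) R. ennreal (P * L powr b * (1 + norm z) powr (- b)) \<partial>lborel)"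
      unfolding kernel_integral_def
    proof (intro nn_integral_mono)
      fix w
      show "ennreal (Im w powr a / norm (cnj w - z) powr b) * indicator V w
          \<le> ennreal (P * L powr b * (1 + norm z) powr (- b)) * indicator (cball 0 R) w"
      proof (cases "w \<in> V")
        case True
        then have w: "w \<in> window R" using V by auto
        have "(1 + norm z) powr b \<le> (L * norm (cnj w - z)) powr b"
          using dist[OF w z] b0 by (intro powr_mono2) auto
        moreover have z1: "0 < 1 + norm z" by (simp add: add_pos_nonneg)
        moreover have "0 < norm (cnj w - z)"
          using less_le_trans[OF z1 dist[OF w z]] L by (auto simp: zero_less_mult_iff)
        ultimately have "1 / norm (cnj w - z) powr b \<le> L powr b * (1 + norm z) powr (- b)"
          using L by (simp add: powr_mult powr_minus field_simps)
        then have "Im w powr a * (1 / norm (cnj w - z) powr b) \<le> P * (L powr b * (1 + norm z) powr (- b))"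
          using P[OF w] by (intro mult_mono) (auto simp: P_def)
        then show ?thesis using True w by (auto simp: window_def mult.assoc intro!: ennreal_leI)
      qed simp
    qed
    also have "\<dots> = ennreal (P * L powr b * (1 + norm z) powr (- b)) * emeasure lborel (cball (0::complex) R)"
      by (simp add: nn_integral_cmult_indicator)
    also have "emeasure lborel (cball (0::complex) R) = ennreal (measure lborel (cball (0::complex) R))"
      by (intro emeasure_eq_ennreal_measure) (use emeasure_lborel_cball_finite in \<open>auto simp: less_top\<close>)
    also have "ennreal (P * L powr b * (1 + norm z) powr (- b)) * \<dots> = ennreal (A * (1 + norm z) powr (- b))"
      by (subst ennreal_mult''[symmetric]) (simp_all add: A_def mult_ac)
    finally show ?thesis .
  qed
  have [measurable]: "Im \<in> borel_measurable borel"
    by (intro borel_measurable_continuous_onI continuous_intros)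
  have "(\<integral>\<^sup>+z\<in>\<complex>\<^sub>+. (ennreal_powr (kernel_integral a b V z) q * ennreal (Im z powr \<nu>)) \<partial>lborel)
     \<le> (\<integral>\<^sup>+z. ennreal (A powr q) * (ennreal ((1 + norm z) powr (- (b * q)) * Im z powr \<nu>) * indicator \<complex>\<^sub>+ z) \<partial>lborel)"
  proof (intro nn_integral_mono)
    fix z
    show "ennreal_powr (kernel_integral a b V z) q * ennreal (Im z powr \<nu>) * indicator \<complex>\<^sub>+ z
       \<le> ennreal (A powr q) * (ennreal ((1 + norm z) powr (- (b * q)) * Im z powr \<nu>) * indicator \<complex>\<^sub>+ z)"
    proof (cases "z \<in> \<complex>\<^sub>+")
      case True
      have "ennreal_powr (kernel_integral a b V z) q \<le> ennreal ((A * (1 + norm z) powr (- b)) powr q)"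
        using ennreal_powr_mono[OF _ kernel[OF True], of q] A q by (simp add: ennreal_powr_ennreal)
      also have "\<dots> = ennreal (A powr q * (1 + norm z) powr (- (b * q)))"
        using A by (simp add: powr_mult powr_powr)
      finally have "ennreal_powr (kernel_integral a b V z) q * ennreal (Im z powr \<nu>)
         \<le> ennreal (A powr q * (1 + norm z) powr (- (b * q))) * ennreal (Im z powr \<nu>)"
        by (intro mult_right_mono) auto
      also have "\<dots> = ennreal (A powr q) * ennreal ((1 + norm z) powr (- (b * q)) * Im z powr \<nu>)"
        by (simp add: ennreal_mult mult.assoc)
      finally show ?thesis using True by simp
    qed simp
  qed
  also have "\<dots> = ennreal (A powr q) * (\<integral>\<^sup>+z\<in>\<complex>\<^sub>+. ennreal ((1 + norm z) powr (- (b * q)) * Im z powr \<nu>) \<partial>lborel)"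
    by (rule nn_integral_cmult) measurable
  also have "\<dots> < \<infinity>"
    using nn_integral_upper_half_plane_decay_finite[OF \<nu> b] by (simp add: ennreal_mult_less_top)
  finally show ?thesis .
qed

section \<open>Approximation in the growth norm\<close>

lemma growth_norm_le_iff:
  assumes "B \<ge> 0"
  shows "growth_norm \<mu> F \<le> ennreal B \<longleftrightarrow> (\<forall>z\<in>\<complex>\<^sub>+. norm (F z) * Im z powr \<mu> \<le> B)"
proof
  assume L: "growth_norm \<mu> F \<le> ennreal B"
  show "\<forall>z\<in>\<complex>\<^sub>+. norm (F z) * Im z powr \<mu> \<le> B"
  proof
    fix z assume z: "z \<in> \<complex>\<^sub>+"
    have "ennreal (norm (F (Complex (Re z) (Im z))) * Im z powr \<mu>) \<le> growth_norm \<mu> F"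
      unfolding growth_norm_def using z
      by (intro SUP_upper2[of "Im z"] SUP_upper2[of "Re z"]) (auto simp: upper_half_plane_def)
    from order_trans[OF this L] show "norm (F z) * Im z powr \<mu> \<le> B" using assms by simp
  qed
next
  assume B: "\<forall>z\<in>\<complex>\<^sub>+. norm (F z) * Im z powr \<mu> \<le> B"
  show "growth_norm \<mu> F \<le> ennreal B"
    unfolding growth_norm_def
  proof (intro SUP_least ennreal_leI)
    show "norm (F (Complex x y)) * y powr \<mu> \<le> B" if "y \<in> {0<..}" for x y
      using that bspec[OF B, of "Complex x y"] by (simp add: upper_half_plane_def)
  qed
qed

lemma bergman_space_cmult:
  assumes q: "q > 0" and g: "g \<in> bergman_space q \<nu>"
  shows "(\<lambda>z. c * g z) \<in> bergman_space q \<nu>"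
proof -
  have hol: "g holomorphic_on \<complex>\<^sub>+"
    and fin: "(\<integral>\<^sup>+z\<in>\<complex>\<^sub>+. ennreal (norm (g z) powr q * Im z powr \<nu>) \<partial>lborel) < \<infinity>"
    using g q by (auto simp: bergman_space_iff)
  have "(\<integral>\<^sup>+z\<in>\<complex>\<^sub>+. ennreal (norm (c * g z) powr q * Im z powr \<nu>) \<partial>lborel)
     = (\<integral>\<^sup>+z. ennreal (norm c powr q) * (ennreal (norm (g z) powr q * Im z powr \<nu>) * indicator \<complex>\<^sub>+ z) \<partial>lborel)"
    by (intro nn_integral_cong) (simp add: norm_mult powr_mult ennreal_mult mult.assoc)
  also have "\<dots> = ennreal (norm c powr q) * (\<integral>\<^sup>+z\<in>\<complex>\<^sub>+. ennreal (norm (g z) powr q * Im z powr \<nu>) \<partial>lborel)"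
    using borel_measurable_bergman_integrand[OF holomorphic_on_imp_continuous_on[OF hol]]
    by (simp add: nn_integral_cmult)
  also have "\<dots> < \<infinity>" using fin by (simp add: ennreal_mult_less_top)
  finally show ?thesis using hol q by (simp add: bergman_space_iff holomorphic_intros)
qed

text \<open>The pointwise bound \<open>\<bar>a + b\<bar> \<le> 2 max \<bar>a\<bar> \<bar>b\<bar>\<close> replaces the triangle inequality, which the norm does
  not satisfy for \<open>q < 1\<close>.\<close>

lemma bergman_space_add:
  assumes q: "q > 0" and g: "g \<in> bergman_space q \<nu>" and h: "h \<in> bergman_space q \<nu>"
  shows "(\<lambda>z. g z + h z) \<in> bergman_space q \<nu>"
proof -
  have hol: "g holomorphic_on \<complex>\<^sub>+" "h holomorphic_on \<complex>\<^sub>+"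
    and fin: "(\<integral>\<^sup>+z\<in>\<complex>\<^sub>+. ennreal (norm (g z) powr q * Im z powr \<nu>) \<partial>lborel) < \<infinity>"
      "(\<integral>\<^sup>+z\<in>\<complex>\<^sub>+. ennreal (norm (h z) powr q * Im z powr \<nu>) \<partial>lborel) < \<infinity>"
    using g h q by (auto simp: bergman_space_iff)
  have meas [measurable]: "(\<lambda>z. ennreal (norm (g z) powr q * Im z powr \<nu>) * indicator \<complex>\<^sub>+ z) \<in> borel_measurable borel"
    "(\<lambda>z. ennreal (norm (h z) powr q * Im z powr \<nu>) * indicator \<complex>\<^sub>+ z) \<in> borel_measurable borel"
    by (intro borel_measurable_bergman_integrand holomorphic_on_imp_continuous_on hol)+
  have "(\<integral>\<^sup>+z\<in>\<complex>\<^sub>+. ennreal (norm (g z + h z) powr q * Im z powr \<nu>) \<partial>lborel)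
     \<le> (\<integral>\<^sup>+z. ennreal (2 powr q) * (ennreal (norm (g z) powr q * Im z powr \<nu>) * indicator \<complex>\<^sub>+ z
         + ennreal (norm (h z) powr q * Im z powr \<nu>) * indicator \<complex>\<^sub>+ z) \<partial>lborel)"
  proof (intro nn_integral_mono)
    fix z
    define m where "m = max (norm (g z)) (norm (h z))"
    have "norm (g z + h z) powr q \<le> (2 * m) powr q"
      using norm_triangle_ineq[of "g z" "h z"] q by (intro powr_mono2) (auto simp: m_def)
    also have "\<dots> = 2 powr q * m powr q" by (simp add: powr_mult m_def)
    also have "m powr q \<le> norm (g z) powr q + norm (h z) powr q" by (auto simp: m_def max_def)
    finally have "norm (g z + h z) powr q * Im z powr \<nu>
        \<le> 2 powr q * (norm (g z) powr q + norm (h z) powr q) * Im z powr \<nu>"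
      by (intro mult_right_mono) auto
    also have "\<dots> = 2 powr q * (norm (g z) powr q * Im z powr \<nu> + norm (h z) powr q * Im z powr \<nu>)"
      by (simp add: algebra_simps)
    finally have "ennreal (norm (g z + h z) powr q * Im z powr \<nu>)
        \<le> ennreal (2 powr q) * (ennreal (norm (g z) powr q * Im z powr \<nu>) + ennreal (norm (h z) powr q * Im z powr \<nu>))"
      by (simp flip: ennreal_plus ennreal_mult add: ennreal_leI)
    then show "ennreal (norm (g z + h z) powr q * Im z powr \<nu>) * indicator \<complex>\<^sub>+ z
        \<le> ennreal (2 powr q) * (ennreal (norm (g z) powr q * Im z powr \<nu>) * indicator \<complex>\<^sub>+ z
         + ennreal (norm (h z) powr q * Im z powr \<nu>) * indicator \<complex>\<^sub>+ z)"
      by (auto simp: indicator_def)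
  qed
  also have "\<dots> = ennreal (2 powr q) * ((\<integral>\<^sup>+z\<in>\<complex>\<^sub>+. ennreal (norm (g z) powr q * Im z powr \<nu>) \<partial>lborel)
     + (\<integral>\<^sup>+z\<in>\<complex>\<^sub>+. ennreal (norm (h z) powr q * Im z powr \<nu>) \<partial>lborel))"
    by (subst nn_integral_cmult) (auto simp: nn_integral_add meas)
  also have "\<dots> < \<infinity>" using fin by (simp add: ennreal_mult_less_top)
  finally show ?thesis using hol q by (simp add: bergman_space_iff holomorphic_intros)
qed

text \<open>The approximants are \<open>f (z + i s) / (1 - i s z)\<^bsup>m\<^esup>\<close> with small \<open>s > 0\<close>. The upward shift makes
  \<open>f\<close> bounded, and the denominator, whose modulus is at least \<open>1\<close> on the half-plane, supplies decay
  at infinity without increasing the growth norm. As \<open>s \<rightarrow> 0\<close> they converge to \<open>f\<close> uniformly on compact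
  sets. They need not come close to \<open>f\<close> in the growth norm.\<close>

lemma bergman_space_bounded_approximation:
  fixes f :: "complex \<Rightarrow> complex"
  assumes hol: "f holomorphic_on \<complex>\<^sub>+"
    and M: "\<And>z. z \<in> \<complex>\<^sub>+ \<Longrightarrow> norm (f z) * Im z powr t \<le> M"
    and q: "q > 0" and t: "t > 0" and \<nu>: "\<nu> > -1" and R: "R > 0" and \<eta>: "\<eta> > 0"
  obtains h where "h \<in> bergman_space q \<nu>"
    "\<And>z. z \<in> \<complex>\<^sub>+ \<Longrightarrow> norm (h z) * Im z powr t \<le> M"
    "\<And>z. z \<in> window R \<Longrightarrow> norm (f z - h z) * Im z powr t \<le> \<eta>"
proof -
  obtain m :: nat where m: "m * q > \<nu> + 2"
    using reals_Archimedean3[OF q] by auto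
  define G where "G = (\<lambda>(s::real, z). f (z + \<i> * of_real s) / (1 - \<i> * of_real s * z) ^ m)"
  have shift: "z + \<i> * of_real s \<in> \<complex>\<^sub>+" if "z \<in> \<complex>\<^sub>+" "s \<ge> 0" for z s
    using that by (simp add: upper_half_plane_def)
  have denom_sq: "1 + (s * norm z)\<^sup>2 \<le> (norm (1 - \<i> * of_real s * z))\<^sup>2" if "z \<in> \<complex>\<^sub>+" "s \<ge> 0" for z s
  proof -
    have "(norm (1 - \<i> * of_real s * z))\<^sup>2 = (1 + s * Im z)\<^sup>2 + (s * Re z)\<^sup>2"
      by (simp add: cmod_power2)
    also have "\<dots> = 1 + s\<^sup>2 * ((Re z)\<^sup>2 + (Im z)\<^sup>2) + 2 * (s * Im z)"
      by (simp add: algebra_simps power2_eq_square)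
    also have "s\<^sup>2 * ((Re z)\<^sup>2 + (Im z)\<^sup>2) = (s * norm z)\<^sup>2"
      by (simp add: power_mult_distrib cmod_power2)
    finally show ?thesis using that by (simp add: upper_half_plane_def)
  qed
  have denom1: "1 \<le> norm (1 - \<i> * of_real s * z)" if "z \<in> \<complex>\<^sub>+" "s \<ge> 0" for z s
    using denom_sq[OF that] by (intro power2_le_imp_le[of 1]) (auto intro: order_trans[rotated])
  have denom2: "s * norm z \<le> norm (1 - \<i> * of_real s * z)" if "z \<in> \<complex>\<^sub>+" "s \<ge> 0" for z s
    using denom_sq[OF that] by (intro power2_le_imp_le[of "s * norm z"]) auto
  have nz: "1 - \<i> * of_real s * z \<noteq> 0" if "z \<in> \<complex>\<^sub>+" "s \<ge> 0" for z s
    using denom1[OF that] by auto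
  have WC: "window R \<subseteq> \<complex>\<^sub>+" using R by (rule window_subset)
  have "continuous_on ({0..1} \<times> window R) G"
  proof -
    have "continuous_on ({0..1} \<times> window R) (\<lambda>x. f (snd x + \<i> * of_real (fst x)))"
      by (rule continuous_on_compose2[OF holomorphic_on_imp_continuous_on[OF hol]])
        (use WC shift in \<open>auto intro!: continuous_intros\<close>)
    then show ?thesis
      unfolding G_def split_beta
      using WC nz by (intro continuous_intros) auto
  qed
  then have "uniformly_continuous_on ({0..1} \<times> window R) G"
    by (intro compact_uniformly_continuous compact_Times compact_window) auto
  moreover have "\<eta> / R powr t > 0" using \<eta> R by simp
  ultimately obtain d where d: "d > 0" "\<And>x x'. \<lbrakk>x \<in> {0..1} \<times> window R; x' \<in> {0..1} \<times> window R; dist x' x < d\<rbrakk>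
      \<Longrightarrow> dist (G x') (G x) < \<eta> / R powr t"
    unfolding uniformly_continuous_on_def by metis
  define s where "s = min 1 (d / 2)"
  have s: "0 < s" "s \<le> 1" "s < d" using d by (auto simp: s_def)
  define h where "h z = f (z + \<i> * of_real s) / (1 - \<i> * of_real s * z) ^ m" for z
  have hbound: "norm (h z) * Im z powr t \<le> M" if z: "z \<in> \<complex>\<^sub>+" for z
  proof -
    have "norm (h z) \<le> norm (f (z + \<i> * of_real s))"
      unfolding h_def norm_divide norm_power
    proof -
      have "1 \<le> norm (1 - \<i> * of_real s * z) ^ m" using denom1[OF z, of s] s by (intro one_le_power) auto
      then show "norm (f (z + \<i> * of_real s)) / norm (1 - \<i> * of_real s * z) ^ m \<le> norm (f (z + \<i> * of_real s))"
        using divide_left_mono[of 1 "norm (1 - \<i> * of_real s * z) ^ m" "norm (f (z + \<i> * of_real s))"]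
        by (simp add: less_le_trans[OF zero_less_one])
    qed
    then have "norm (h z) * Im z powr t \<le> norm (f (z + \<i> * of_real s)) * Im (z + \<i> * of_real s) powr t"
      using z s t by (intro mult_mono powr_mono2) (auto simp: upper_half_plane_def)
    also have "\<dots> \<le> M" using z s by (intro M shift) auto
    finally show ?thesis .
  qed
  have hclose: "norm (f z - h z) * Im z powr t \<le> \<eta>" if z: "z \<in> window R" for z
  proof -
    have "dist (G (s, z)) (G (0, z)) < \<eta> / R powr t"
      using z s by (intro d) (auto simp: dist_Pair_Pair)
    then have "norm (f z - h z) \<le> \<eta> / R powr t"
      by (simp add: G_def h_def dist_norm norm_minus_commute)
    moreover have "Im z powr t \<le> R powr t"
      using z WC t abs_Im_le_cmod[of z]
      by (intro powr_mono2) (auto simp: window_def upper_half_plane_def)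
    ultimately have "norm (f z - h z) * Im z powr t \<le> \<eta> / R powr t * R powr t"
      using \<eta> by (intro mult_mono) auto
    then show ?thesis using R by simp
  qed
  have "h \<in> bergman_space q \<nu>"
  proof -
    have hhol: "h holomorphic_on \<complex>\<^sub>+"
    proof -
      have "(f \<circ> (\<lambda>z. z + \<i> * of_real s)) holomorphic_on \<complex>\<^sub>+"
        using s shift by (intro holomorphic_on_compose_gen[OF _ hol]) (auto intro!: holomorphic_intros)
      then show ?thesis
        unfolding h_def using s nz by (intro holomorphic_intros) (auto simp: o_def)
    qed
    define A where "A = M * s powr (- t) * (2 / s) ^ m"
    have decay: "norm (h z) \<le> A * (1 + norm z) powr (- real m)" if z: "z \<in> \<complex>\<^sub>+" for z
    proof -
      have "norm (f (z + \<i> * of_real s)) * s powr t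
          \<le> norm (f (z + \<i> * of_real s)) * Im (z + \<i> * of_real s) powr t"
        using z s t by (intro mult_left_mono powr_mono2) (auto simp: upper_half_plane_def)
      also have "\<dots> \<le> M" using z s by (intro M shift) auto
      finally have 1: "norm (f (z + \<i> * of_real s)) \<le> M * s powr (- t)"
        using s by (simp add: powr_minus field_simps)
      have "s * (1 + norm z) \<le> 2 * norm (1 - \<i> * of_real s * z)"
        using denom1[OF z, of s] denom2[OF z, of s] s by (simp add: algebra_simps)
      then have 2: "(s / 2 * (1 + norm z)) ^ m \<le> norm (1 - \<i> * of_real s * z) ^ m"
        using s by (intro power_mono) auto
      have pos: "0 < s / 2 * (1 + norm z)" using s by (intro mult_pos_pos add_pos_nonneg) auto
      have "norm (h z) \<le> M * s powr (- t) / (s / 2 * (1 + norm z)) ^ m"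
        unfolding h_def norm_divide norm_power
        using 1 2 zero_less_power[OF pos] order_trans[OF norm_ge_zero 1] by (intro frac_le)
      also have "\<dots> = A * (1 + norm z) powr (- real m)"
      proof -
        have "(1 + norm z) powr (- real m) = 1 / (1 + norm z) ^ m"
          by (simp add: powr_minus powr_realpow add_pos_nonneg divide_inverse)
        then show ?thesis by (simp add: A_def power_mult_distrib power_divide)
      qed
      finally show ?thesis .
    qed
    have A: "A \<ge> 0"
      using order_trans[OF norm_ge_zero decay[of \<i>]] by (auto simp: upper_half_plane_def zero_le_mult_iff)
    have [measurable]: "Im \<in> borel_measurable borel"
      by (intro borel_measurable_continuous_onI continuous_intros)
    have "(\<integral>\<^sup>+z\<in>\<complex>\<^sub>+. ennreal (norm (h z) powr q * Im z powr \<nu>) \<partial>lborel)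
      \<le> (\<integral>\<^sup>+z. ennreal (A powr q) * (ennreal ((1 + norm z) powr (- (m * q)) * Im z powr \<nu>) * indicator \<complex>\<^sub>+ z) \<partial>lborel)"
    proof (intro nn_integral_mono)
      fix z
      show "ennreal (norm (h z) powr q * Im z powr \<nu>) * indicator \<complex>\<^sub>+ z
        \<le> ennreal (A powr q) * (ennreal ((1 + norm z) powr (- (m * q)) * Im z powr \<nu>) * indicator \<complex>\<^sub>+ z)"
      proof (cases "z \<in> \<complex>\<^sub>+")
        case True
        have "norm (h z) powr q \<le> (A * (1 + norm z) powr (- real m)) powr q"
          using decay[OF True] q by (intro powr_mono2) auto
        also have "\<dots> = A powr q * (1 + norm z) powr (- (m * q))"
          using A by (simp add: powr_mult powr_powr)
        finally have "norm (h z) powr q * Im z powr \<nu> \<le> A powr q * (1 + norm z) powr (- (m * q)) * Im z powr \<nu>"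
          by (intro mult_right_mono) auto
        then show ?thesis using True by (simp add: mult.assoc ennreal_leI flip: ennreal_mult')
      qed simp
    qed
    also have "\<dots> = ennreal (A powr q) * (\<integral>\<^sup>+z\<in>\<complex>\<^sub>+. ennreal ((1 + norm z) powr (- (m * q)) * Im z powr \<nu>) \<partial>lborel)"
      by (rule nn_integral_cmult) measurable
    also have "\<dots> < \<infinity>"
      using nn_integral_upper_half_plane_decay_finite[OF \<nu> m] by (simp add: ennreal_mult_less_top)
    finally show ?thesis using hhol q by (simp add: bergman_space_iff)
  qed
  then show ?thesis using hbound hclose by (rule that)
qed

text \<open>The approximant \<open>S / N\<close> is an average of \<open>N\<close> functions \<open>h\<close> of the kind just constructed. Each new
  \<open>h\<close> is chosen close to \<open>f\<close> on a window outside which the sum of the earlier ones is small.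
  Hence, at any given point, all but at most one of the summands are either close to \<open>f\<close> or small, and
  where they are small and outside the window given for \<open>f\<close>, the error is essentially \<open>\<bar>f\<bar>\<close>, at most
  \<open>e\<close> after weighting. The single exceptional summand costs \<open>2M\<close> once, not once for each step:
  in the induction step the old bound is used inside the new window, and the bound outside
  it is proved afresh.\<close>

lemma bergman_space_averaged_approximation:
  fixes f :: "complex \<Rightarrow> complex"
  assumes hol: "f holomorphic_on \<complex>\<^sub>+"
    and M: "\<And>z. z \<in> \<complex>\<^sub>+ \<Longrightarrow> norm (f z) * Im z powr t \<le> M"
    and q: "q > 0" and t: "t * q = \<nu> + 2" and \<nu>: "\<nu> > -1"
    and R: "R > 0" "V_set e t f \<subseteq> window R" and e: "e \<ge> 0" and \<eta>: "\<eta> > 0"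
  shows "\<exists>S \<in> bergman_space q \<nu>. \<forall>z\<in>\<complex>\<^sub>+. norm (of_nat N * f z - S z) * Im z powr t \<le> N * (e + \<eta>) + 2 * M"
proof (induction N)
  have t0: "t > 0"
  proof -
    have "0 < t * q" using t \<nu> by linarith
    then show ?thesis using q by (simp add: zero_less_mult_iff)
  qed
  have M0: "M \<ge> 0"
    using order_trans[OF _ M[of \<i>]] by (auto simp: upper_half_plane_def)
  {
    case 0
    have "(\<lambda>z. 0) \<in> bergman_space q \<nu>" using q by (simp add: bergman_space_iff)
    then show ?case using M0 by (intro bexI[of _ "\<lambda>z. 0"]) auto
  next
    case (Suc N)
    then obtain S where S: "S \<in> bergman_space q \<nu>"
      "\<And>z. z \<in> \<complex>\<^sub>+ \<Longrightarrow> norm (of_nat N * f z - S z) * Im z powr t \<le> N * (e + \<eta>) + 2 * M"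
      by auto
    obtain R' where R': "R' > 0" "V_set \<eta> t S \<subseteq> window R'"
      by (rule bergman_space_vanishes_at_boundary[OF q t \<eta> S(1)]) (rule that)
    define R1 where "R1 = max R R'"
    have R1: "R1 > 0" "window R \<subseteq> window R1" "window R' \<subseteq> window R1"
      using R R' by (auto simp: R1_def intro!: window_mono del: subsetI)
    obtain h where h: "h \<in> bergman_space q \<nu>"
      "\<And>z. z \<in> \<complex>\<^sub>+ \<Longrightarrow> norm (h z) * Im z powr t \<le> M"
      "\<And>z. z \<in> window R1 \<Longrightarrow> norm (f z - h z) * Im z powr t \<le> \<eta>"
      by (rule bergman_space_bounded_approximation[OF hol _ q t0 \<nu> R1(1) \<eta>, of M])
        (rule M, assumption, rule that, assumption+)
    show ?case
    proof (intro bexI[of _ "\<lambda>z. S z + h z"] ballI)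
      show "(\<lambda>z. S z + h z) \<in> bergman_space q \<nu>" using q S(1) h(1) by (rule bergman_space_add)
      fix z assume z: "z \<in> \<complex>\<^sub>+"
      define y where "y = Im z powr t"
      have y: "y \<ge> 0" by (simp add: y_def)
      show "norm (of_nat (Suc N) * f z - (S z + h z)) * Im z powr t \<le> Suc N * (e + \<eta>) + 2 * M"
      proof (cases "z \<in> window R1")
        case True
        have "of_nat (Suc N) * f z - (S z + h z) = (of_nat N * f z - S z) + (f z - h z)"
          by (simp add: algebra_simps)
        then have "norm (of_nat (Suc N) * f z - (S z + h z)) * y
            \<le> (norm (of_nat N * f z - S z) + norm (f z - h z)) * y"
          using y by (metis mult_right_mono norm_triangle_ineq)
        also have "\<dots> \<le> (N * (e + \<eta>) + 2 * M) + \<eta>"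
          using S(2)[OF z] h(3)[OF True] by (simp add: y_def distrib_right)
        also have "\<dots> \<le> Suc N * (e + \<eta>) + 2 * M" using e by (simp add: algebra_simps)
        finally show ?thesis by (simp add: y_def)
      next
        case False
        then have f: "norm (f z) * y \<le> e" and Sz: "norm (S z) * y \<le> \<eta>"
          using R(2) R'(2) R1 z by (auto simp: V_set_def y_def not_le subset_iff intro: less_imp_le)
        have "norm (of_nat (Suc N) * f z - (S z + h z)) \<le> Suc N * norm (f z) + (norm (S z) + norm (h z))"
          using norm_triangle_ineq4[of "of_nat (Suc N) * f z" "S z + h z"] norm_triangle_ineq[of "S z" "h z"]
          by (simp only: norm_mult norm_of_nat)
        then have "norm (of_nat (Suc N) * f z - (S z + h z)) * y
            \<le> (Suc N * norm (f z) + (norm (S z) + norm (h z))) * y"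
          using y by (rule mult_right_mono)
        also have "\<dots> = Suc N * (norm (f z) * y) + norm (S z) * y + norm (h z) * y"
          by (simp only: distrib_right mult.assoc add.assoc)
        also have "\<dots> \<le> Suc N * e + \<eta> + M"
          using f Sz h(2)[OF z] by (intro add_mono mult_left_mono) (auto simp: y_def)
        also have "\<dots> \<le> Suc N * (e + \<eta>) + 2 * M"
          using \<eta> M0 by (simp add: algebra_simps)
        finally show ?thesis by (simp add: y_def)
      qed
    qed
  }
qed

text \<open>Dividing the preceding sum by a large \<open>N\<close> makes the cost \<open>2M / N\<close> of the exceptional summand
  negligible. This is why the distance equals the boundary limsup and is not merely comparable to it.\<close>

lemma dist_bergman_le:
  fixes f :: "complex \<Rightarrow> complex"
  assumes hol: "f holomorphic_on \<complex>\<^sub>+"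
    and M: "\<And>z. z \<in> \<complex>\<^sub>+ \<Longrightarrow> norm (f z) * Im z powr t \<le> M"
    and q: "q > 0" and t: "t * q = \<nu> + 2" and \<nu>: "\<nu> > -1"
    and e: "e \<ge> 0" and V: "\<And>\<eta>. \<eta> > 0 \<Longrightarrow> \<exists>R>0. V_set (e + \<eta>) t f \<subseteq> window R"
  shows "dist_wrt (growth_norm t) f (bergman_space q \<nu>) \<le> ennreal e"
proof (rule ennreal_le_epsilon)
  fix d :: real assume d: "0 < d"
  have M0: "M \<ge> 0"
    using order_trans[OF _ M[of \<i>]] by (auto simp: upper_half_plane_def)
  define \<eta> where "\<eta> = d / 3"
  have \<eta>: "\<eta> > 0" using d by (simp add: \<eta>_def)
  obtain R where R: "R > 0" "V_set (e + \<eta>) t f \<subseteq> window R" using V[OF \<eta>] by auto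
  obtain N :: nat where N: "2 * M / \<eta> < N" using reals_Archimedean2 by blast
  have "0 \<le> 2 * M / \<eta>" using M0 \<eta> by simp
  then have N0: "real N > 0" using N by linarith
  obtain S where S: "S \<in> bergman_space q \<nu>"
    "\<And>z. z \<in> \<complex>\<^sub>+ \<Longrightarrow> norm (of_nat N * f z - S z) * Im z powr t \<le> N * (e + \<eta> + \<eta>) + 2 * M"
    using bergman_space_averaged_approximation[OF hol _ q t \<nu> R _ \<eta>, of M N] M e \<eta> by auto
  define g where "g z = 1 / of_nat N * S z" for z
  have g: "g \<in> bergman_space q \<nu>"
    unfolding g_def using q S(1) by (rule bergman_space_cmult)
  have "norm (f z - g z) * Im z powr t \<le> e + d" if z: "z \<in> \<complex>\<^sub>+" for z
  proof -
    have "f z - g z = (of_nat N * f z - S z) / of_nat N"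
      using N0 by (simp add: g_def field_simps)
    then have "norm (f z - g z) * Im z powr t = norm (of_nat N * f z - S z) * Im z powr t / N"
      by (simp add: norm_divide)
    also have "\<dots> \<le> (N * (e + \<eta> + \<eta>) + 2 * M) / N"
      using S(2)[OF z] by (intro divide_right_mono) auto
    also have "\<dots> = e + \<eta> + \<eta> + 2 * M / N" using N0 by (simp add: field_simps)
    also have "2 * M / N \<le> \<eta>" using N N0 \<eta> by (simp add: field_simps)
    finally show ?thesis by (simp add: \<eta>_def)
  qed
  then have "growth_norm t (\<lambda>z. f z - g z) \<le> ennreal (e + d)"
    using e d by (subst growth_norm_le_iff) auto
  then show "dist_wrt (growth_norm t) f (bergman_space q \<nu>) \<le> ennreal e + ennreal d"
    unfolding dist_wrt_def using g e d by (intro INF_lower2[OF g]) simp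
qed

section \<open>The distance formula\<close>

theorem theorem3:
  fixes q \<nu> t \<beta> :: real and f :: "complex \<Rightarrow> complex"
  assumes "0 < q" and "q \<le> 1" and "\<nu> > -1"
    and "t = (\<nu> + 2) / q"
    and "\<beta> > (\<nu> + 2) / q - 2"
    and "f \<in> growth_space ((\<nu> + 2) / q)"
  shows "dist_wrt (growth_norm ((\<nu> + 2) / q)) f (bergman_space q \<nu>) =
    (INF \<epsilon> \<in> {\<epsilon>::real. \<epsilon> > 0 \<and>
       (\<integral>\<^sup>+z\<in>\<complex>\<^sub>+.
          (ennreal_powr
             (\<integral>\<^sup>+w\<in>V_set \<epsilon> t f. ennreal (Im w powr (\<beta> - t) / norm (cnj w - z) powr (\<beta> + 2)) \<partial>lborel)
             q
           * ennreal (Im z powr \<nu>)) \<partial>lborel) < \<infinity>}. ennreal \<epsilon>)"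
proof -
  have t: "t * q = \<nu> + 2" "t > 0" using assms by auto
  have \<beta>: "\<beta> + 2 > t" using assms by simp
  have hol: "f holomorphic_on \<complex>\<^sub>+" and fin: "growth_norm t f < \<infinity>"
    using assms by (auto simp: growth_space_def)
  define M where "M = enn2real (growth_norm t f)"
  have "growth_norm t f \<le> ennreal M" using fin by (simp add: M_def less_top)
  then have M: "norm (f z) * Im z powr t \<le> M" if "z \<in> \<complex>\<^sub>+" for z
    using that growth_norm_le_iff[of M t f] by (simp add: M_def)
  define E where "E = {\<epsilon>::real. \<epsilon> > 0 \<and>
       (\<integral>\<^sup>+z\<in>\<complex>\<^sub>+. (ennreal_powr (kernel_integral (\<beta> - t) (\<beta> + 2) (V_set \<epsilon> t f) z) q
           * ennreal (Im z powr \<nu>)) \<partial>lborel) < \<infinity>}"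
  have "dist_wrt (growth_norm t) f (bergman_space q \<nu>) = (INF \<epsilon>\<in>E. ennreal \<epsilon>)"
  proof (rule antisym)
    \<comment> \<open>A finite integral at level \<open>\<epsilon>\<close> bounds the boundary limsup of the weighted \<open>\<bar>f\<bar>\<close> by \<open>\<epsilon>\<close>.\<close>
    show "dist_wrt (growth_norm t) f (bergman_space q \<nu>) \<le> (INF \<epsilon>\<in>E. ennreal \<epsilon>)"
    proof (rule INF_greatest)
      fix \<epsilon> assume \<epsilon>: "\<epsilon> \<in> E"
      show "dist_wrt (growth_norm t) f (bergman_space q \<nu>) \<le> ennreal \<epsilon>"
      proof (rule dist_bergman_le[OF hol M assms(1) t(1) assms(3)])
        show "0 \<le> \<epsilon>" using \<epsilon> by (simp add: E_def)
        fix \<eta> :: real assume \<eta>: "\<eta> > 0"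
        have fin\<epsilon>: "(\<integral>\<^sup>+z\<in>\<complex>\<^sub>+. (ennreal_powr (kernel_integral (\<beta> - t) (\<beta> + 2) (V_set \<epsilon> t f) z) q
           * ennreal (Im z powr \<nu>)) \<partial>lborel) < \<infinity>" using \<epsilon> by (simp add: E_def)
        have \<beta>2: "\<beta> \<ge> -2" using \<beta> t by linarith
        show "\<exists>R>0. V_set (\<epsilon> + \<eta>) t f \<subseteq> window R"
          by (rule V_set_window_if_integral_finite[OF hol _ assms(1) t \<beta>2 \<eta> fin\<epsilon>, of M])
            (rule M, assumption, blast)
      qed
    qed
    \<comment> \<open>Above the level \<open>e\<close>, \<open>f\<close> exceeds its distance to \<open>g\<close>, so \<open>g\<close> cannot be small there.\<close>
    show "(INF \<epsilon>\<in>E. ennreal \<epsilon>) \<le> dist_wrt (growth_norm t) f (bergman_space q \<nu>)"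
      unfolding dist_wrt_def
    proof (rule INF_greatest, rule ennreal_le_epsilon)
      fix g and \<delta> :: real
      assume g: "g \<in> bergman_space q \<nu>" and lt: "growth_norm t (\<lambda>z. f z - g z) < top" and \<delta>: "0 < \<delta>"
      define e where "e = enn2real (growth_norm t (\<lambda>z. f z - g z))"
      have e: "growth_norm t (\<lambda>z. f z - g z) = ennreal e" "e \<ge> 0" using lt by (simp_all add: e_def)
      then have close: "norm (f z - g z) * Im z powr t \<le> e" if "z \<in> \<complex>\<^sub>+" for z
        using that growth_norm_le_iff[of e t "\<lambda>z. f z - g z"] by simp
      obtain R where R: "R > 0" "V_set \<delta> t g \<subseteq> window R"
        by (rule bergman_space_vanishes_at_boundary[OF assms(1) t(1) \<delta> g]) (rule that)
      have "V_set (e + \<delta>) t f \<subseteq> V_set \<delta> t g"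
      proof
        fix z assume z: "z \<in> V_set (e + \<delta>) t f"
        then have zC: "z \<in> \<complex>\<^sub>+" by (simp add: V_set_def)
        have "e + \<delta> \<le> norm (f z) * Im z powr t" using z by (simp add: V_set_def)
        also have "\<dots> \<le> (norm (f z - g z) + norm (g z)) * Im z powr t"
          by (intro mult_right_mono) (auto simp: norm_triangle_sub add.commute)
        finally show "z \<in> V_set \<delta> t g"
          using close[OF zC] zC by (simp add: V_set_def distrib_right)
      qed
      then have V: "V_set (e + \<delta>) t f \<subseteq> window R" using R by blast
      have "(\<beta> + 2) * q > t * q" using \<beta> assms(1) by (intro mult_strict_right_mono)
      then have "e + \<delta> \<in> E"
        unfolding E_def using integral_finite_if_window[OF V R(1) assms(1,3), of "\<beta> + 2" "\<beta> - t"] t e \<delta> by auto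
      then have "(INF \<epsilon>\<in>E. ennreal \<epsilon>) \<le> ennreal (e + \<delta>)" by (rule INF_lower)
      then show "(INF \<epsilon>\<in>E. ennreal \<epsilon>) \<le> growth_norm t (\<lambda>z. f z - g z) + ennreal \<delta>"
        using e \<delta> by simp
    qed
  qed
  then show ?thesis by (simp only: E_def kernel_integral_def assms(4))
qed

end
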